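(* Let $n = n(j) = m_1 + m_2 + \cdots + m_j$ with $1 \leq j \leq j_{\max}$. In the Hermitian case described below, the structure-preserving Padé-type model with data matrices $\mathcal A_n = \mathcal V_n^H \mathcal A\, \mathcal V_n$, $\mathcal E_n = \mathcal V_n^H \mathcal E\, \mathcal V_n$, $\mathcal B_n = \mathcal V_n^H \mathcal B$, $\mathcal L_n = \mathcal L\, \mathcal V_n$, $\mathcal D_n = \mathcal D$ satisfies \[ H_n(s) = H(s) + {\mathcal O}\bigl((s-s_0)^{2 j(n)} \bigr), \] where $H_n(s) = \mathcal D_n + \mathcal L_n (s\mathcal E_n - \mathcal A_n)^{-1}\mathcal B_n$.
   Context: Consider a first-order system $\mathcal E\, \frac{d}{dt} z(t) - \mathcal A\, z(t) = \mathcal B\, u(t)$, $y(t) = \mathcal D\, u(t) + \mathcal L\, z(t)$, with regular pencil $s\mathcal E - \mathcal A$ and transfer function $H(s) = \mathcal D + \mathcal L (s\mathcal E - \mathcal A)^{-1}\mathcal B$, which is the equivalent first-order formulation of one of the following Hermitian systems. (a) A Hermitian special second-order system $P_1 \frac{d}{dt}x + P_0 x + P_{-1}\int_{t_0}^t x\,d\tau = B u$, $y = D u + L x$, with either $P_{-1} = F_1 G F_2^H$ or $P_{-1} = F_1 G^{-1} F_2^H$ ($G$ nonsingular), where Hermitian means $L = B^H$, $P_0 = P_0^H$, $P_1 = P_1^H$, $F_1 = F_2$, $G = G^H$. Here $P_0,P_1\in\mathbb{C}^{N\times N}$, $G\in\mathbb{C}^{N_0\times N_0}$, and the first-order data are $\mathcal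 B = \begin{bmatrix} B\\ 0\end{bmatrix}$, $\mathcal L = \begin{bmatrix} L & 0\end{bmatrix}$, $\mathcal D = D$, and either $\mathcal A = \begin{bmatrix} -P_0 & -F_1 G\\ (F_2G)^H & 0\end{bmatrix}$, $\mathcal E = \begin{bmatrix} P_1 & 0\\ 0 & G^H\end{bmatrix}$ (first case) or $\mathcal A = \begin{bmatrix} -P_0 & -F_1\\ F_2^H & 0\end{bmatrix}$, $\mathcal E = \begin{bmatrix} P_1 & 0\\ 0 & G\end{bmatrix}$ (second case). (b) A Hermitian $l$-th order system $P_l x^{(l)} + \cdots + P_1 x' + P_0 x = B u$, $y = D u + L_{l-1}x^{(l-1)} + \cdots + L_0 x$, where Hermitian means $P_i = P_i^H$ ($0\le i\le l$), $L_0 = B^H$, $L_j = 0$ ($1\le j\le l-1$); the first-order data are the companion form with state $(x, x', \dots, x^{(l-1)})$: $\mathcal E = \mathrm{diag}(I,\dots,I,P_l)$, $\mathcal A = -\begin{bmatrix} 0 & -I & & \\ & \ddots & \ddots & \\ & & 0 & -I\\ P_0 & P_1 & \cdots & P_{l-1}\end{bmatrix}$, $\mathcal B = \begin{bmatrix}0\\ \vdots\\ 0\\ B\end{bmatrix}$, $\mathcal L = \begin{bmatrix} L_0 & L_1 & \cdots & L_{l-1}\end{bmatrix}$, $\mathcal D = D$. Let $s_0 \in \mathbb{R}$ with $s_0\mathcal E - \mathcal A$ nonsingular, and set $\mathcal M = (s_0\mathcal E - \mathcal A)^{-1}\mathcal E$, $\mathcal R = (s_0\mathcal E - \mathcal A)^{-1}\mathcal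 B$. Deflating the block-Krylov matrix $[\mathcal R,\ \mathcal M\mathcal R,\ \mathcal M^2\mathcal R,\dots]$ (deleting columns linearly dependent on earlier ones) gives $[\mathcal R^{(1)},\ \mathcal M\mathcal R^{(2)},\dots,\mathcal M^{j_{\max}-1}\mathcal R^{(j_{\max})}]$ where block $\mathcal R^{(j)}$ has $m_j$ columns; for $n = m_1+\cdots+m_j$, the block-Krylov subspace is $\mathcal K_n(\mathcal M,\mathcal R) = \mathrm{range}[\mathcal R^{(1)}, \mathcal M\mathcal R^{(2)}, \dots, \mathcal M^{j-1}\mathcal R^{(j)}]$. The projection matrix $\mathcal V_n$ is: in case (a), $\mathcal V_n = \begin{bmatrix} V_1 & 0\\ 0 & V_2\end{bmatrix}$, where $\begin{bmatrix} V_1\\ V_2\end{bmatrix}$ ($V_1$ with $N$ rows, $V_2$ with $N_0$ rows) is any matrix whose columns span $\mathcal K_n(\mathcal M,\mathcal R)$ (and $V_2^H G V_2$ is nonsingular); in case (b), $\mathcal V_n = \mathrm{diag}(S_n,\dots,S_n)$ ($l$ copies) with $S_n\in\mathbb{C}^{N\times n}$, $S_n^H S_n = I_n$, chosen so that $\mathcal K_n(\mathcal M,\mathcal R)\subseteq \mathrm{range}\,\mathcal V_n$. The projected pencil $s\mathcal E_n - \mathcal A_n$ is assumed regular and $s_0\mathcal E_n - \mathcal A_n$ nonsingular. *)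

theory Defs
  imports "Jordan_Normal_Form.Determinant" "Jordan_Normal_Form.Gauss_Jordan_Elimination" "HOL-Library.Landau_Symbols"
begin

definition cadj :: "complex mat \<Rightarrow> complex mat" where
  "cadj A = mat (dim_col A) (dim_row A) (\<lambda>(i,k). cnj (A $$ (k,i)))"

definition hermitian_mat :: "complex mat \<Rightarrow> bool" where
  "hermitian_mat A \<longleftrightarrow> cadj A = A"

definition minv :: "complex mat \<Rightarrow> complex mat" where
  "minv A = (case mat_inverse A of Some B \<Rightarrow> B | None \<Rightarrow> 0\<^sub>m (dim_col A) (dim_row A))"

definition nonsingular :: "complex mat \<Rightarrow> bool" where
  "nonsingular A \<longleftrightarrow> dim_row A = dim_col A \<and> det A \<noteq> 0"

definition regular_pencil :: "complex mat \<Rightarrow> complex mat \<Rightarrow> bool" where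
  "regular_pencil E A \<longleftrightarrow> (\<exists>K. E \<in> carrier_mat K K \<and> A \<in> carrier_mat K K)
     \<and> (\<exists>s::complex. det (s \<cdot>\<^sub>m E - A) \<noteq> 0)"

definition transfer :: "complex mat \<Rightarrow> complex mat \<Rightarrow> complex mat \<Rightarrow> complex mat \<Rightarrow> complex mat
   \<Rightarrow> complex \<Rightarrow> complex mat" where
  "transfer E A B L D s = D + L * minv (s \<cdot>\<^sub>m E - A) * B"

definition col_space :: "complex mat \<Rightarrow> complex vec set" where
  "col_space V = {V *\<^sub>v x | x. x \<in> carrier_vec (dim_col V)}"

definition Mmat :: "complex mat \<Rightarrow> complex mat \<Rightarrow> real \<Rightarrow> complex mat" where
  "Mmat E A s0 = minv (complex_of_real s0 \<cdot>\<^sub>m E - A) * E"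

definition Rmat :: "complex mat \<Rightarrow> complex mat \<Rightarrow> complex mat \<Rightarrow> real \<Rightarrow> complex mat" where
  "Rmat E A B s0 = minv (complex_of_real s0 \<cdot>\<^sub>m E - A) * B"

definition kcol :: "complex mat \<Rightarrow> complex mat \<Rightarrow> nat \<Rightarrow> nat \<Rightarrow> complex vec" where
  "kcol M R k i = (M ^\<^sub>m k) *\<^sub>v col R i"

definition kcols_before :: "complex mat \<Rightarrow> complex mat \<Rightarrow> nat \<Rightarrow> nat \<Rightarrow> complex vec list" where
  "kcols_before M R k i =
     [kcol M R k' i'. k' \<leftarrow> [0..<k], i' \<leftarrow> [0..<dim_col R]] @ [kcol M R k i'. i' \<leftarrow> [0..<i]]"

definition kept :: "complex mat \<Rightarrow> complex mat \<Rightarrow> nat \<Rightarrow> nat \<Rightarrow> bool" where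
  "kept M R k i \<longleftrightarrow>
     kcol M R k i \<notin> col_space (mat_of_cols (dim_row M) (kcols_before M R k i))"

text \<open>m_j = number of columns of the deflated block R^(j) (j >= 1), i.e. of kept
  columns among M^(j-1) r_1, ..., M^(j-1) r_m.\<close>
definition mblk :: "complex mat \<Rightarrow> complex mat \<Rightarrow> nat \<Rightarrow> nat" where
  "mblk M R j = card {i. i < dim_col R \<and> kept M R (j - 1) i}"

definition nblk :: "complex mat \<Rightarrow> complex mat \<Rightarrow> nat \<Rightarrow> nat" where
  "nblk M R j = (\<Sum>j'=1..j. mblk M R j')"

definition krylov_space :: "complex mat \<Rightarrow> complex mat \<Rightarrow> nat \<Rightarrow> complex vec set" where
  "krylov_space M R j = col_space (mat_of_cols (dim_row M)
     [kcol M R k i. k \<leftarrow> [0..<j], i \<leftarrow> filter (kept M R k) [0..<dim_col R]])"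

definition blkdiag2 :: "complex mat \<Rightarrow> complex mat \<Rightarrow> complex mat" where
  "blkdiag2 X Y = four_block_mat X (0\<^sub>m (dim_row X) (dim_col Y)) (0\<^sub>m (dim_row Y) (dim_col X)) Y"

text \<open>Case (a), first variant: P_{-1} = F G F^H (F = F_1 = F_2).\<close>
definition herm_a1 :: "nat \<Rightarrow> nat \<Rightarrow> complex mat \<Rightarrow> complex mat \<Rightarrow> complex mat \<Rightarrow> complex mat
   \<Rightarrow> complex mat \<Rightarrow> complex mat \<Rightarrow> complex mat \<Rightarrow> complex mat \<Rightarrow> complex mat \<Rightarrow> complex mat \<Rightarrow> complex mat \<Rightarrow> bool" where
  "herm_a1 N N0 P0 P1 F G B D E A Bf Lf Df \<longleftrightarrow>
     P0 \<in> carrier_mat N N \<and> P1 \<in> carrier_mat N N \<and> F \<in> carrier_mat N N0 \<and> G \<in> carrier_mat N0 N0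
     \<and> B \<in> carrier_mat N (dim_col B) \<and> D \<in> carrier_mat (dim_col B) (dim_col B)
     \<and> hermitian_mat P0 \<and> hermitian_mat P1 \<and> hermitian_mat G
     \<and> A = four_block_mat (- P0) (- (F * G)) (cadj (F * G)) (0\<^sub>m N0 N0)
     \<and> E = blkdiag2 P1 (cadj G)
     \<and> Bf = B @\<^sub>r 0\<^sub>m N0 (dim_col B)
     \<and> Lf = four_block_mat (cadj B) (0\<^sub>m (dim_col B) N0) (0\<^sub>m 0 N) (0\<^sub>m 0 N0)
     \<and> Df = D"

text \<open>Case (a), second variant: P_{-1} = F G^{-1} F^H, G nonsingular.\<close>
definition herm_a2 :: "nat \<Rightarrow> nat \<Rightarrow> complex mat \<Rightarrow> complex mat \<Rightarrow> complex mat \<Rightarrow> complex mat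
   \<Rightarrow> complex mat \<Rightarrow> complex mat \<Rightarrow> complex mat \<Rightarrow> complex mat \<Rightarrow> complex mat \<Rightarrow> complex mat \<Rightarrow> complex mat \<Rightarrow> bool" where
  "herm_a2 N N0 P0 P1 F G B D E A Bf Lf Df \<longleftrightarrow>
     P0 \<in> carrier_mat N N \<and> P1 \<in> carrier_mat N N \<and> F \<in> carrier_mat N N0 \<and> G \<in> carrier_mat N0 N0
     \<and> B \<in> carrier_mat N (dim_col B) \<and> D \<in> carrier_mat (dim_col B) (dim_col B)
     \<and> hermitian_mat P0 \<and> hermitian_mat P1 \<and> hermitian_mat G \<and> nonsingular G
     \<and> A = four_block_mat (- P0) (- F) (cadj F) (0\<^sub>m N0 N0)
     \<and> E = blkdiag2 P1 G
     \<and> Bf = B @\<^sub>r 0\<^sub>m N0 (dim_col B)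
     \<and> Lf = four_block_mat (cadj B) (0\<^sub>m (dim_col B) N0) (0\<^sub>m 0 N) (0\<^sub>m 0 N0)
     \<and> Df = D"

definition proj_a :: "nat \<Rightarrow> nat \<Rightarrow> complex mat \<Rightarrow> complex vec set \<Rightarrow> complex mat \<Rightarrow> bool" where
  "proj_a N N0 G Kn Vn \<longleftrightarrow> (\<exists>V1 V2 q. V1 \<in> carrier_mat N q \<and> V2 \<in> carrier_mat N0 q
     \<and> col_space (V1 @\<^sub>r V2) = Kn \<and> nonsingular (cadj V2 * G * V2)
     \<and> Vn = blkdiag2 V1 V2)"

text \<open>Case (b): l-th order system with coefficients P 0, ..., P l (state (x, x', ..., x^(l-1))).
  Block (r,c) of an lN x lN matrix is entry (r div N, c div N).\<close>
definition herm_b :: "nat \<Rightarrow> nat \<Rightarrow> (nat \<Rightarrow> complex mat) \<Rightarrow> complex mat \<Rightarrow> complex mat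
   \<Rightarrow> complex mat \<Rightarrow> complex mat \<Rightarrow> complex mat \<Rightarrow> complex mat \<Rightarrow> complex mat \<Rightarrow> bool" where
  "herm_b N l P B D E A Bf Lf Df \<longleftrightarrow>
     1 \<le> l \<and> (\<forall>i\<le>l. P i \<in> carrier_mat N N \<and> hermitian_mat (P i))
     \<and> B \<in> carrier_mat N (dim_col B) \<and> D \<in> carrier_mat (dim_col B) (dim_col B)
     \<and> E = mat (l*N) (l*N) (\<lambda>(r,c). if r div N = c div N then
            (if r div N = l - 1 then P l $$ (r mod N, c mod N) else (if r mod N = c mod N then 1 else 0))
          else 0)
     \<and> A = mat (l*N) (l*N) (\<lambda>(r,c).
            if r div N = l - 1 then - (P (c div N) $$ (r mod N, c mod N))
            else if c div N = r div N + 1 \<and> r mod N = c mod N then 1 else 0)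
     \<and> Bf = mat (l*N) (dim_col B) (\<lambda>(r,c). if r div N = l - 1 then B $$ (r mod N, c) else 0)
     \<and> Lf = mat (dim_col B) (l*N) (\<lambda>(r,c). if c div N = 0 then cnj (B $$ (c mod N, r)) else 0)
     \<and> Df = D"

definition proj_b :: "nat \<Rightarrow> nat \<Rightarrow> nat \<Rightarrow> complex vec set \<Rightarrow> complex mat \<Rightarrow> bool" where
  "proj_b N l n Kn Vn \<longleftrightarrow> (\<exists>S. S \<in> carrier_mat N n \<and> cadj S * S = 1\<^sub>m n
     \<and> Vn = mat (l*N) (l*n) (\<lambda>(r,c). if r div N = c div n then S $$ (r mod N, c mod n) else 0)
     \<and> Kn \<subseteq> col_space Vn)"

end

theory Submission
  imports Defs
begin

text \<open>
  Let C(s) = sE - A, X(s) = C(s)^-1 B and X_n(s) = V (V^H C(s) V)^-1 V^H B. The Neumann recursion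
  X = R + (s0 - s) M X shows that X(s) = V Z(s) + \<Delta>(s) with \<Delta> of order (s - s0)^j, because the first j
  blocks M^k R lie in the range of V. The Galerkin condition V^H C (X - X_n) = 0 gives one factor
  (s - s0)^j for X - X_n. If C(s)^H J = J C(cnj s), J B = B and J maps the range of V into
  itself, then the left solution is J X(cnj s), since s0 is real. Hence, for L = B^H, the error is
  B^H (X - X_n) = \<Delta>(cnj s)^H J^H C (X - X_n), which has order 2j.

  In case (a) one takes J = diag(I, -I). The companion pencil of case (b) has no such symmetry with
  respect to V = diag(S, ..., S), but its resolvent maps the last block column to the first block row
  by the inverse of the Hermitian matrix polynomial P(s), and the same relation holds between the
  projected pencil and S^H P(s) S. So the argument applies to P(s) and S with J = I.
\<close>

section \<open>Matrix functions and their entrywise order\<close>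

lemma cadj_carrier [simp, intro]: "A \<in> carrier_mat n m \<Longrightarrow> cadj A \<in> carrier_mat m n"
  by (simp add: cadj_def)

lemma dim_cadj [simp]: "dim_row (cadj A) = dim_col A" "dim_col (cadj A) = dim_row A"
  by (simp_all add: cadj_def)

lemma index_cadj [simp]: "i < dim_col A \<Longrightarrow> k < dim_row A \<Longrightarrow> cadj A $$ (i,k) = cnj (A $$ (k,i))"
  by (simp add: cadj_def)

lemma cadj_cadj [simp]: "cadj (cadj A) = A"
  by (rule eq_matI) auto

lemma cadj_mult:
  assumes "A \<in> carrier_mat n k" "B \<in> carrier_mat k m"
  shows "cadj (A * B) = cadj B * cadj A"
  using assms by (intro eq_matI) (auto simp: scalar_prod_def mult.commute)

lemma cadj_add:
  assumes "A \<in> carrier_mat n m" "B \<in> carrier_mat n m"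
  shows "cadj (A + B) = cadj A + cadj B"
  using assms by (intro eq_matI) auto

lemma cadj_minus:
  assumes "A \<in> carrier_mat n m" "B \<in> carrier_mat n m"
  shows "cadj (A - B) = cadj A - cadj B"
  using assms by (intro eq_matI) auto

lemma cadj_smult: "cadj (c \<cdot>\<^sub>m A) = cnj c \<cdot>\<^sub>m cadj A"
  by (intro eq_matI) auto

lemma cadj_uminus: "cadj (- A) = - cadj A"
  by (intro eq_matI) auto

lemma cadj_zero [simp]: "cadj (0\<^sub>m n m) = 0\<^sub>m m n"
  by (intro eq_matI) auto

lemma cadj_four_block_mat:
  assumes "A \<in> carrier_mat nr1 nc1" "B \<in> carrier_mat nr1 nc2"
    and "C \<in> carrier_mat nr2 nc1" "D \<in> carrier_mat nr2 nc2"
  shows "cadj (four_block_mat A B C D) = four_block_mat (cadj A) (cadj C) (cadj B) (cadj D)"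
  using assms by (intro eq_matI) (auto simp: not_less)

text \<open>The default of \<open>minv\<close> on a singular matrix is a zero matrix of the right
  size, so a resolvent has a fixed size at every s, including the points where the pencil is
  singular.\<close>

lemma minv_carrier [simp, intro]:
  assumes "A \<in> carrier_mat n n"
  shows "minv A \<in> carrier_mat n n"
  using assms mat_inverse(2)[OF assms] by (auto simp: minv_def split: option.split)

lemma minv_inverse:
  assumes A: "A \<in> carrier_mat n n" and det: "det A \<noteq> 0"
  shows "A * minv A = 1\<^sub>m n" "minv A * A = 1\<^sub>m n"
proof -
  have "mat_inverse A \<noteq> None"
    using mat_inverse(1)[OF A, where b = "()"] det_non_zero_imp_unit[OF A det, where b = "()"] by blast
  then show "A * minv A = 1\<^sub>m n" "minv A * A = 1\<^sub>m n"
    using mat_inverse(2)[OF A] by (auto simp: minv_def)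
qed

text \<open>Cramer's rule makes the entries of a resolvent quotients of polynomials in the entries
  of the pencil; its boundedness near s0 rests on this.\<close>

lemma minv_eq_adj_mat:
  assumes A: "A \<in> carrier_mat n n" and det: "det A \<noteq> 0"
  shows "minv A = (1 / det A) \<cdot>\<^sub>m adj_mat A"
proof -
  have "A * ((1 / det A) \<cdot>\<^sub>m adj_mat A) = 1\<^sub>m n"
    using A det adj_mat[OF A] by (subst mult_smult_distrib[of _ n n _ n]) auto
  then have "minv A = minv A * (A * ((1 / det A) \<cdot>\<^sub>m adj_mat A))"
    using minv_carrier[OF A] by simp
  also have "\<dots> = minv A * A * ((1 / det A) \<cdot>\<^sub>m adj_mat A)"
    using A adj_mat(1)[OF A] by (subst assoc_mult_mat[of _ n n _ n _ n]) auto
  also have "\<dots> = (1 / det A) \<cdot>\<^sub>m adj_mat A"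
    using minv_inverse(2)[OF A det] adj_mat(1)[OF A] by auto
  finally show ?thesis .
qed

lemma isCont_det:
  fixes C :: "complex \<Rightarrow> complex mat"
  assumes "\<And>s. C s \<in> carrier_mat n n"
    and "\<And>i k. i < n \<Longrightarrow> k < n \<Longrightarrow> isCont (\<lambda>s. C s $$ (i,k)) z"
  shows "isCont (\<lambda>s. det (C s)) z"
proof -
  have "det (C s) = (\<Sum>p | p permutes {0..<n}. signof p * (\<Prod>i = 0..<n. C s $$ (i, p i)))" for s
    using det_def'[OF assms(1)] .
  then show ?thesis
    using assms(2) by (auto intro!: continuous_intros dest: permutes_in_image)
qed

lemma isCont_adj_mat:
  fixes C :: "complex \<Rightarrow> complex mat"
  assumes C: "\<And>s. C s \<in> carrier_mat n n"
    and cont: "\<And>i k. i < n \<Longrightarrow> k < n \<Longrightarrow> isCont (\<lambda>s. C s $$ (i,k)) z"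
    and i: "i < n" and k: "k < n"
  shows "isCont (\<lambda>s. adj_mat (C s) $$ (i,k)) z"
proof -
  have eq: "adj_mat (C s) $$ (i,k) = (-1) ^ (k + i) * det (mat_delete (C s) k i)" for s
    using C[of s] i k by (simp add: adj_mat_def cofactor_def)
  have "isCont (\<lambda>s. det (mat_delete (C s) k i)) z"
  proof (rule isCont_det[of _ "n - 1"])
    fix a b assume ab: "a < n - 1" "b < n - 1"
    \<comment> \<open>Deleting row k and column i shifts the later indices by one, so each entry of
      the minor is one fixed entry of \<open>C s\<close>, the same for all s.\<close>
    have "mat_delete (C s) k i $$ (a,b)
        = C s $$ (if a < k then a else Suc a, if b < i then b else Suc b)" for s
      using C[of s] ab by (simp add: mat_delete_def)
    then show "isCont (\<lambda>s. mat_delete (C s) k i $$ (a,b)) z"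
      using cont ab by simp
  qed (use C mat_delete_carrier in blast)
  then show ?thesis
    unfolding eq by (auto intro!: continuous_intros)
qed

text \<open>The size is prescribed for every s, the bound only near s0, so that matrix functions can
  be composed without nonsingularity conditions. Order p = 0 means that all entries are bounded on a
  punctured neighbourhood of s0.\<close>

definition mat_bigo :: "real \<Rightarrow> nat \<Rightarrow> nat \<Rightarrow> nat \<Rightarrow> (complex \<Rightarrow> complex mat) \<Rightarrow> bool" where
  "mat_bigo s0 p n m F \<longleftrightarrow> (\<forall>s. F s \<in> carrier_mat n m) \<and>
     (\<forall>i<n. \<forall>k<m. (\<lambda>s. F s $$ (i,k)) \<in> O[at (complex_of_real s0)](\<lambda>s. (s - complex_of_real s0) ^ p))"

lemma mat_bigo_carrier: "mat_bigo s0 p n m F \<Longrightarrow> F s \<in> carrier_mat n m"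
  by (simp add: mat_bigo_def)

lemma mat_bigo_cont:
  assumes "\<And>s. F s \<in> carrier_mat n m"
    and "\<And>i k. i < n \<Longrightarrow> k < m \<Longrightarrow> isCont (\<lambda>s. F s $$ (i,k)) (complex_of_real s0)"
  shows "mat_bigo s0 0 n m F"
  unfolding mat_bigo_def
proof (intro conjI allI impI)
  fix i k assume "i < n" "k < m"
  then have "((\<lambda>s. F s $$ (i,k) / 1) \<longlongrightarrow> F s0 $$ (i,k)) (at (complex_of_real s0))"
    using assms(2) by (auto simp: isCont_def)
  from bigoI_tendsto[OF this]
  show "(\<lambda>s. F s $$ (i,k)) \<in> O[at (complex_of_real s0)](\<lambda>s. (s - complex_of_real s0) ^ 0)"
    by simp
qed (use assms in auto)

lemma mat_bigo_const: "A \<in> carrier_mat n m \<Longrightarrow> mat_bigo s0 0 n m (\<lambda>_. A)"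
  by (rule mat_bigo_cont) auto

lemma mat_bigo_mult:
  assumes F: "mat_bigo s0 p n k F" and G: "mat_bigo s0 q k m G"
  shows "mat_bigo s0 (p + q) n m (\<lambda>s. F s * G s)"
  unfolding mat_bigo_def
proof (intro conjI allI impI)
  show "F s * G s \<in> carrier_mat n m" for s
    using mat_bigo_carrier[OF F] mat_bigo_carrier[OF G] by (rule mult_carrier_mat)
  fix i j assume ij: "i < n" "j < m"
  have "(F s * G s) $$ (i,j) = (\<Sum>c = 0..<k. F s $$ (i,c) * G s $$ (c,j))" for s
    using ij mat_bigo_carrier[OF F, of s] mat_bigo_carrier[OF G, of s]
    by (auto simp: scalar_prod_def)
  moreover have "(\<lambda>s. \<Sum>c = 0..<k. F s $$ (i,c) * G s $$ (c,j))
      \<in> O[at (complex_of_real s0)](\<lambda>s. (s - complex_of_real s0) ^ (p + q))"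
    unfolding power_add using F G ij
    by (intro big_sum_in_bigo landau_o.big.mult) (auto simp: mat_bigo_def)
  ultimately show "(\<lambda>s. (F s * G s) $$ (i,j))
      \<in> O[at (complex_of_real s0)](\<lambda>s. (s - complex_of_real s0) ^ (p + q))"
    by simp
qed

lemma mat_bigo_minus:
  assumes F: "mat_bigo s0 p n m F" and G: "mat_bigo s0 p n m G"
  shows "mat_bigo s0 p n m (\<lambda>s. F s - G s)"
  unfolding mat_bigo_def
proof (intro conjI allI impI)
  show "F s - G s \<in> carrier_mat n m" for s
    using mat_bigo_carrier[OF G] by (rule minus_carrier_mat)
  fix i k assume ik: "i < n" "k < m"
  have "(F s - G s) $$ (i,k) = F s $$ (i,k) - G s $$ (i,k)" for s
    using ik mat_bigo_carrier[OF G, of s] by auto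
  then show "(\<lambda>s. (F s - G s) $$ (i,k))
      \<in> O[at (complex_of_real s0)](\<lambda>s. (s - complex_of_real s0) ^ p)"
    using F G ik by (auto simp: mat_bigo_def intro: sum_in_bigo)
qed

text \<open>The remainder of the Neumann recursion carries powers of s0 - s, whereas orders are
  measured in s - s0; the norms agree.\<close>

lemma mat_bigo_power_smult:
  assumes F: "mat_bigo s0 0 n m F"
  shows "mat_bigo s0 p n m (\<lambda>s. (complex_of_real s0 - s) ^ p \<cdot>\<^sub>m F s)"
  unfolding mat_bigo_def
proof (intro conjI allI impI)
  show "(complex_of_real s0 - s) ^ p \<cdot>\<^sub>m F s \<in> carrier_mat n m" for s
    using mat_bigo_carrier[OF F] by simp
  fix i k assume ik: "i < n" "k < m"
  have eq: "((complex_of_real s0 - s) ^ p \<cdot>\<^sub>m F s) $$ (i,k)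
      = (complex_of_real s0 - s) ^ p * F s $$ (i,k)" for s
    using ik mat_bigo_carrier[OF F, of s] by auto
  have "(\<lambda>s. (complex_of_real s0 - s) ^ p) \<in> O[at (complex_of_real s0)](\<lambda>s. (s - complex_of_real s0) ^ p)"
    by (rule bigoI[where c = 1]) (simp add: norm_power norm_minus_commute)
  from landau_o.big.mult[OF this, of "\<lambda>s. F s $$ (i,k)" "\<lambda>_. 1"]
  show "(\<lambda>s. ((complex_of_real s0 - s) ^ p \<cdot>\<^sub>m F s) $$ (i,k))
      \<in> O[at (complex_of_real s0)](\<lambda>s. (s - complex_of_real s0) ^ p)"
    unfolding eq using F ik by (auto simp: mat_bigo_def)
qed

text \<open>A real s0 is fixed by conjugation and no other point is sent to it, so punctured
  neighbourhoods of s0 are preserved. The factor of the error taken at cnj s owes its order to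
  this.\<close>

lemma filterlim_cnj_at_real:
  "filterlim cnj (at (complex_of_real s0)) (at (complex_of_real s0))"
proof -
  have "(cnj \<longlongrightarrow> cnj (complex_of_real s0)) (at (complex_of_real s0))"
    by (intro tendsto_intros)
  moreover have "eventually (\<lambda>s. cnj s \<noteq> complex_of_real s0) (at (complex_of_real s0))"
    unfolding eventually_at_filter by (auto simp: complex_eq_iff)
  ultimately show ?thesis by (simp add: filterlim_at)
qed

lemma mat_bigo_cadj_cnj:
  assumes F: "mat_bigo s0 p n m F"
  shows "mat_bigo s0 p m n (\<lambda>s. cadj (F (cnj s)))"
  unfolding mat_bigo_def
proof (intro conjI allI impI)
  show "cadj (F (cnj s)) \<in> carrier_mat m n" for s
    using mat_bigo_carrier[OF F] by simp
  fix i k assume ik: "i < m" "k < n"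
  have eq: "cadj (F (cnj s)) $$ (i,k) = cnj (F (cnj s) $$ (k,i))" for s
    using ik mat_bigo_carrier[OF F, of "cnj s"] by auto
  have n: "norm (cnj s - complex_of_real s0) = norm (s - complex_of_real s0)" for s
    by (metis complex_cnj_complex_of_real complex_cnj_diff complex_mod_cnj)
  have "(\<lambda>s. F s $$ (k,i)) \<in> O[at (complex_of_real s0)](\<lambda>s. (s - complex_of_real s0) ^ p)"
    using F ik by (auto simp: mat_bigo_def)
  from landau_o.big.compose[OF this filterlim_cnj_at_real]
  show "(\<lambda>s. cadj (F (cnj s)) $$ (i,k))
      \<in> O[at (complex_of_real s0)](\<lambda>s. (s - complex_of_real s0) ^ p)"
    unfolding eq bigo_def by (simp add: norm_power n)
qed

lemma pencil_entry_isCont: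
  fixes E A :: "complex mat"
  assumes "E \<in> carrier_mat n n" "A \<in> carrier_mat n n" "i < n" "k < n"
  shows "isCont (\<lambda>s. (s \<cdot>\<^sub>m E - A) $$ (i,k)) z"
proof -
  have "(s \<cdot>\<^sub>m E - A) $$ (i,k) = s * E $$ (i,k) - A $$ (i,k)" for s
    using assms by auto
  then show ?thesis by (auto intro!: continuous_intros)
qed

lemma pencil_nonsingular_eventually:
  fixes E A :: "complex mat"
  assumes E: "E \<in> carrier_mat n n" and A: "A \<in> carrier_mat n n"
    and det: "det (z \<cdot>\<^sub>m E - A) \<noteq> 0"
  shows "eventually (\<lambda>s. det (s \<cdot>\<^sub>m E - A) \<noteq> 0) (at z)"
proof -
  have "isCont (\<lambda>s. det (s \<cdot>\<^sub>m E - A)) z"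
    using pencil_entry_isCont[OF E A] A by (intro isCont_det) auto
  then show ?thesis
    using det by (auto simp: isCont_def intro: tendsto_imp_eventually_ne)
qed

text \<open>By the adjugate formula each entry agrees, near s0, with a quotient that is continuous
  at s0, hence bounded there.\<close>

lemma mat_bigo_resolvent:
  assumes E: "E \<in> carrier_mat n n" and A: "A \<in> carrier_mat n n"
    and det: "det (complex_of_real s0 \<cdot>\<^sub>m E - A) \<noteq> 0"
  shows "mat_bigo s0 0 n n (\<lambda>s. minv (s \<cdot>\<^sub>m E - A))"
  unfolding mat_bigo_def
proof (intro conjI allI impI)
  have C: "s \<cdot>\<^sub>m E - A \<in> carrier_mat n n" for s using A by auto
  then show "minv (s \<cdot>\<^sub>m E - A) \<in> carrier_mat n n" for s by auto
  fix i k assume ik: "i < n" "k < n"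
  let ?f = "\<lambda>s. adj_mat (s \<cdot>\<^sub>m E - A) $$ (i,k) / det (s \<cdot>\<^sub>m E - A)"
  have "isCont ?f (complex_of_real s0)"
    using C pencil_entry_isCont[OF E A] det ik
    by (intro isCont_divide isCont_adj_mat[of _ n] isCont_det[of _ n]) auto
  then have "?f \<in> O[at (complex_of_real s0)](\<lambda>_. 1)"
    by (intro bigoI_tendsto[of _ _ "?f s0"]) (auto simp: isCont_def)
  moreover have "eventually (\<lambda>s. minv (s \<cdot>\<^sub>m E - A) $$ (i,k) = ?f s) (at (complex_of_real s0))"
    using pencil_nonsingular_eventually[OF E A det]
  proof eventually_elim
    case (elim s)
    then show ?case
      using minv_eq_adj_mat[OF C elim] adj_mat(1)[OF C, of s] ik by auto
  qed
  ultimately show "(\<lambda>s. minv (s \<cdot>\<^sub>m E - A) $$ (i,k))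
      \<in> O[at (complex_of_real s0)](\<lambda>s. (s - complex_of_real s0) ^ 0)"
    by (simp add: landau_o.big.in_cong)
qed

section \<open>Matrix laws whose side conditions are equations between dimensions\<close>

lemma assoc_mult_mat_dim:
  fixes A B C :: "complex mat"
  assumes "dim_col A = dim_row B" "dim_col B = dim_row C"
  shows "A * B * C = A * (B * C)"
  using assms by (intro assoc_mult_mat[of A "dim_row A" "dim_col A" B "dim_col B" C "dim_col C"]) auto

lemma mult_add_distrib_dim:
  fixes A B C :: "complex mat"
  assumes "dim_col A = dim_row B" "dim_row B = dim_row C" "dim_col B = dim_col C"
  shows "A * (B + C) = A * B + A * C"
  using assms by (intro mult_add_distrib_mat[of A "dim_row A" "dim_col A" B "dim_col B" C]) auto

lemma add_mult_distrib_dim: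
  fixes A B C :: "complex mat"
  assumes "dim_row A = dim_row B" "dim_col A = dim_col B" "dim_col A = dim_row C"
  shows "(A + B) * C = A * C + B * C"
  using assms by (intro add_mult_distrib_mat[of A "dim_row A" "dim_col A" B C "dim_col C"]) auto

lemma mult_minus_distrib_dim:
  fixes A B C :: "complex mat"
  assumes "dim_col A = dim_row B" "dim_row B = dim_row C" "dim_col B = dim_col C"
  shows "A * (B - C) = A * B - A * C"
  using assms by (intro mult_minus_distrib_mat[of A "dim_row A" "dim_col A" B "dim_col B" C]) auto

lemma minus_mult_distrib_dim:
  fixes A B C :: "complex mat"
  assumes "dim_row A = dim_row B" "dim_col A = dim_col B" "dim_col A = dim_row C"
  shows "(A - B) * C = A * C - B * C"
  using assms by (intro minus_mult_distrib_mat[of A "dim_row A" "dim_col A" B C "dim_col C"]) auto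

section \<open>Krylov expansion of the resolvent\<close>

text \<open>Each listed vector has some coefficient vector over V; these coefficient vectors, chosen
  once and used as columns, form Z.\<close>

lemma mat_of_cols_factor:
  assumes V: "V \<in> carrier_mat K q" and vs: "set vs \<subseteq> col_space V"
  shows "\<exists>Z \<in> carrier_mat q (length vs). mat_of_cols K vs = V * Z"
proof -
  have "\<forall>k \<in> {..<length vs}. \<exists>x. x \<in> carrier_vec q \<and> vs ! k = V *\<^sub>v x"
  proof
    fix k assume "k \<in> {..<length vs}"
    then have "vs ! k \<in> col_space V" using vs nth_mem by blast
    then show "\<exists>x. x \<in> carrier_vec q \<and> vs ! k = V *\<^sub>v x" using V by (auto simp: col_space_def)
  qed
  from bchoice[OF this] obtain f where f: "\<And>k. k < length vs \<Longrightarrow> f k \<in> carrier_vec q"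
    "\<And>k. k < length vs \<Longrightarrow> vs ! k = V *\<^sub>v f k"
    by auto
  let ?Z = "mat_of_cols q (map f [0..<length vs])"
  have "mat_of_cols K vs = V * ?Z"
  proof (rule eq_matI)
    fix i k assume "i < dim_row (V * ?Z)" "k < dim_col (V * ?Z)"
    then have ik: "i < K" "k < length vs" using V by auto
    then have "col ?Z k = f k" using f(1) by (subst col_mat_of_cols) auto
    then show "mat_of_cols K vs $$ (i,k) = (V * ?Z) $$ (i,k)"
      using V ik f(2)[OF ik(2)] by (simp add: mat_of_cols_index)
  qed (use V in auto)
  moreover have "?Z \<in> carrier_mat q (length vs)"
    using mat_of_cols_carrier(1)[of q "map f [0..<length vs]"] by simp
  ultimately show ?thesis by blast
qed

lemma col_space_mult_subset:
  assumes "V \<in> carrier_mat K q" "Z \<in> carrier_mat q m"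
  shows "col_space (V * Z) \<subseteq> col_space V"
proof
  fix v assume "v \<in> col_space (V * Z)"
  then obtain x where x: "x \<in> carrier_vec m" "v = (V * Z) *\<^sub>v x"
    using assms by (auto simp: col_space_def)
  then have "v = V *\<^sub>v (Z *\<^sub>v x)" using assms by (simp add: assoc_mult_mat_vec)
  then show "v \<in> col_space V" using assms x by (auto simp: col_space_def)
qed

lemma in_col_space_mat_of_cols:
  assumes v: "v \<in> set vs" and vs: "set vs \<subseteq> carrier_vec K"
  shows "v \<in> col_space (mat_of_cols K vs)"
proof -
  obtain k where k: "k < length vs" "v = vs ! k" using v by (metis in_set_conv_nth)
  have "mat_of_cols K vs *\<^sub>v unit_vec (length vs) k = col (mat_of_cols K vs) k"
    using k by (intro eq_vecI) auto
  then have "v = mat_of_cols K vs *\<^sub>v unit_vec (length vs) k"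
    using k v vs by (simp add: subset_iff)
  then show ?thesis by (auto simp: col_space_def)
qed

text \<open>Deflation loses nothing: a deleted column lies in the span of the columns before it, and
  by induction those already lie in the span of the kept ones.\<close>

lemma kcol_in_krylov_space:
  assumes M: "M \<in> carrier_mat K K" and R: "R \<in> carrier_mat K m" and "k < j" "i < m"
  shows "kcol M R k i \<in> krylov_space M R j"
proof -
  define L where "L = [kcol M R k i. k \<leftarrow> [0..<j], i \<leftarrow> filter (kept M R k) [0..<dim_col R]]"
  define V where "V = mat_of_cols K L"
  have kc: "kcol M R k i \<in> carrier_vec K" for k i
    using M R by (auto simp: kcol_def intro!: mult_mat_vec_carrier[of _ K K])
  then have L: "set L \<subseteq> carrier_vec K" by (auto simp: L_def)
  have V: "V \<in> carrier_mat K (length L)" by (simp add: V_def)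
  have "k < j \<Longrightarrow> i < m \<Longrightarrow> kcol M R k i \<in> col_space V" for k i
  \<comment> \<open>\<open>k * m + i\<close> is the position of the column in the block-Krylov
    matrix, so every column listed in \<open>kcols_before\<close> has a smaller value.\<close>
  proof (induction "k * m + i" arbitrary: k i rule: less_induct)
    case less
    show ?case
    proof (cases "kept M R k i")
      case True
      then have "kcol M R k i \<in> set L" using less.prems R by (force simp: L_def)
      then show ?thesis unfolding V_def using L by (rule in_col_space_mat_of_cols)
    next
      case False
      have "set (kcols_before M R k i) \<subseteq> col_space V"
      proof
        fix v assume "v \<in> set (kcols_before M R k i)"
        then consider k' i' where "k' < k" "i' < m" "v = kcol M R k' i'"
          | i' where "i' < i" "v = kcol M R k i'"
          using R by (auto simp: kcols_before_def)
        then show "v \<in> col_space V"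
        proof cases
          case 1
          have "k' * m + i' < Suc k' * m" using 1 by simp
          also have "\<dots> \<le> k * m + i"
            using 1 by (metis Suc_leI mult_le_mono1 trans_le_add1)
          finally show ?thesis using less 1 by simp
        next
          case 2
          then show ?thesis using less by simp
        qed
      qed
      then obtain Z where "Z \<in> carrier_mat (length L) (length (kcols_before M R k i))"
        "mat_of_cols K (kcols_before M R k i) = V * Z"
        using mat_of_cols_factor[OF V] by blast
      then show ?thesis
        using False M V col_space_mult_subset[OF V] by (auto simp: kept_def)
    qed
  qed
  then show ?thesis using assms by (simp add: krylov_space_def V_def L_def)
qed

text \<open>Connects the subspace condition, stated through kept columns, with the undeflated blocks
  M^k R that appear in the Neumann recursion.\<close>

lemma krylov_block_factor:
  assumes M: "M \<in> carrier_mat K K" and R: "R \<in> carrier_mat K m" and V: "V \<in> carrier_mat K q"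
    and sub: "krylov_space M R j \<subseteq> col_space V" and k: "k < j"
  shows "\<exists>W \<in> carrier_mat q m. M ^\<^sub>m k * R = V * W"
proof -
  let ?vs = "map (kcol M R k) [0..<m]"
  have Mk: "M ^\<^sub>m k \<in> carrier_mat K K" using M by simp
  have "M ^\<^sub>m k * R = mat_of_cols K ?vs"
    using Mk R by (intro eq_matI) (auto simp: mat_of_cols_index kcol_def)
  moreover have "set ?vs \<subseteq> col_space V"
    using kcol_in_krylov_space[OF M R k] sub by auto
  ultimately show ?thesis using mat_of_cols_factor[OF V, of ?vs] by simp
qed

text \<open>With X = C(s)^-1 B, the identity C(s0) = C(s) + (s0 - s) E gives C(s0) X = B + (s0 - s)
  E X; multiplication by C(s0)^-1 yields the recursion, which is exact.\<close>

lemma shifted_resolvent_recursion: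
  fixes E A B :: "complex mat"
  assumes E: "E \<in> carrier_mat K K" and A: "A \<in> carrier_mat K K" and B: "B \<in> carrier_mat K m"
    and det0: "det (complex_of_real s0 \<cdot>\<^sub>m E - A) \<noteq> 0" and det: "det (s \<cdot>\<^sub>m E - A) \<noteq> 0"
  shows "minv (s \<cdot>\<^sub>m E - A) * B
    = Rmat E A B s0 + (complex_of_real s0 - s) \<cdot>\<^sub>m (Mmat E A s0 * (minv (s \<cdot>\<^sub>m E - A) * B))"
proof -
  define C0 where "C0 = complex_of_real s0 \<cdot>\<^sub>m E - A"
  define X where "X = minv (s \<cdot>\<^sub>m E - A) * B"
  have C0: "C0 \<in> carrier_mat K K" and C: "s \<cdot>\<^sub>m E - A \<in> carrier_mat K K"
    using A by (auto simp: C0_def)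
  have X: "X \<in> carrier_mat K m"
    unfolding X_def using minv_carrier[OF C] B by (rule mult_carrier_mat)
  have CX: "(s \<cdot>\<^sub>m E - A) * X = B"
    using minv_inverse(1)[OF C det] C B minv_carrier[OF C]
    by (simp add: X_def flip: assoc_mult_mat[of _ K K _ K _ m])
  have EX: "E * X \<in> carrier_mat K m" and AX: "A * X \<in> carrier_mat K m" using E A X by auto
  have "C0 * X = s0 \<cdot>\<^sub>m (E * X) - A * X"
    using E A X by (simp add: C0_def minus_mult_distrib_mat[of _ K K] mult_smult_assoc_mat[of _ K K _ m])
  also have "\<dots> = (s \<cdot>\<^sub>m (E * X) - A * X) + (s0 - s) \<cdot>\<^sub>m (E * X)"
    using carrier_matD[OF EX] carrier_matD[OF AX]
    by (intro eq_matI) (auto simp: algebra_simps simp del: index_mult_mat)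
  also have "s \<cdot>\<^sub>m (E * X) - A * X = B"
    using E A X CX by (simp add: minus_mult_distrib_mat[of _ K K] mult_smult_assoc_mat[of _ K K _ m])
  finally have C0X: "C0 * X = B + (s0 - s) \<cdot>\<^sub>m (E * X)" .
  have "X = minv C0 * (C0 * X)"
    using minv_inverse(2)[OF C0] det0 C0 X
    by (simp add: C0_def flip: assoc_mult_mat[of _ K K _ K _ m])
  also have "\<dots> = minv C0 * B + (s0 - s) \<cdot>\<^sub>m (minv C0 * E * X)"
    unfolding C0X using minv_carrier[OF C0] B EX E X
    by (simp add: mult_add_distrib_mat[of _ K K _ m] mult_smult_distrib[of _ K K _ m])
  finally show ?thesis by (simp add: X_def Rmat_def Mmat_def C0_def)
qed

text \<open>Substituting the recursion into itself j times produces the blocks M^k R with k < j, all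
  in the range of V, and a remainder with factor (s0 - s)^j. Only the size of Z is recorded, since
  the V Z part drops out of the projection error.\<close>

lemma resolvent_krylov_expansion:
  fixes E A B :: "complex mat"
  assumes E: "E \<in> carrier_mat K K" and A: "A \<in> carrier_mat K K" and B: "B \<in> carrier_mat K m"
    and V: "V \<in> carrier_mat K q"
    and det0: "det (complex_of_real s0 \<cdot>\<^sub>m E - A) \<noteq> 0"
    and sub: "krylov_space (Mmat E A s0) (Rmat E A B s0) j \<subseteq> col_space V"
  shows "\<exists>Z \<Delta>. (\<forall>s. Z s \<in> carrier_mat q m) \<and> mat_bigo s0 j K m \<Delta> \<and>
    (\<forall>\<^sub>F s in at (complex_of_real s0). minv (s \<cdot>\<^sub>m E - A) * B = V * Z s + \<Delta> s)"
proof -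
  define M where "M = Mmat E A s0"
  define R where "R = Rmat E A B s0"
  define X where "X = (\<lambda>s. minv (s \<cdot>\<^sub>m E - A) * B)"
  have C: "s \<cdot>\<^sub>m E - A \<in> carrier_mat K K" for s using A by auto
  have M: "M \<in> carrier_mat K K" and R: "R \<in> carrier_mat K m"
    unfolding M_def R_def Mmat_def Rmat_def
    using mult_carrier_mat[OF minv_carrier[OF C] E] mult_carrier_mat[OF minv_carrier[OF C] B] by auto
  have Mk: "M ^\<^sub>m k \<in> carrier_mat K K" for k using M by simp
  have bX: "mat_bigo s0 0 K m X"
    using mat_bigo_mult[OF mat_bigo_resolvent[OF E A det0] mat_bigo_const[OF B]]
    by (simp add: X_def)
  have X: "X s \<in> carrier_mat K m" for s using mat_bigo_carrier[OF bX] .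
  have step: "\<forall>\<^sub>F s in at (complex_of_real s0). X s = R + (complex_of_real s0 - s) \<cdot>\<^sub>m (M * X s)"
    using pencil_nonsingular_eventually[OF E A det0]
    unfolding X_def M_def R_def
    by eventually_elim (rule shifted_resolvent_recursion[OF E A B det0])
  have "k \<le> j \<Longrightarrow> \<exists>Z. (\<forall>s. Z s \<in> carrier_mat q m) \<and>
    (\<forall>\<^sub>F s in at (complex_of_real s0).
       X s = V * Z s + (complex_of_real s0 - s) ^ k \<cdot>\<^sub>m (M ^\<^sub>m k * X s))" for k
  proof (induction k)
    case 0
    have "X s = V * 0\<^sub>m q m + (complex_of_real s0 - s) ^ 0 \<cdot>\<^sub>m (M ^\<^sub>m 0 * X s)" for s
      using V M X[of s] by (auto intro!: eq_matI)
    then show ?case by (intro exI[of _ "\<lambda>_. 0\<^sub>m q m"]) auto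
  next
    case (Suc k)
    then obtain Z where Z: "\<And>s. Z s \<in> carrier_mat q m"
      and eq: "\<forall>\<^sub>F s in at (complex_of_real s0).
         X s = V * Z s + (complex_of_real s0 - s) ^ k \<cdot>\<^sub>m (M ^\<^sub>m k * X s)"
      by auto
    \<comment> \<open>The recursion, inserted into the remainder, splits off M^k R. Its index
      satisfies k < j, so it factors through V and its coefficient (s0 - s)^k W moves into
      Z.\<close>
    obtain W where W: "W \<in> carrier_mat q m" "M ^\<^sub>m k * R = V * W"
      using krylov_block_factor[OF M R V _, of j k] sub Suc.prems by (auto simp: M_def R_def)
    have "\<forall>\<^sub>F s in at (complex_of_real s0). X s = V * (Z s + (complex_of_real s0 - s) ^ k \<cdot>\<^sub>m W)
        + (complex_of_real s0 - s) ^ Suc k \<cdot>\<^sub>m (M ^\<^sub>m Suc k * X s)"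
      using eq step
    proof eventually_elim
      case (elim s)
      let ?d = "complex_of_real s0 - s"
      have MX: "M * X s \<in> carrier_mat K m" using M X by auto
      have "M ^\<^sub>m k * X s = M ^\<^sub>m k * (R + ?d \<cdot>\<^sub>m (M * X s))" using elim(2) by simp
      also have "\<dots> = V * W + ?d \<cdot>\<^sub>m (M ^\<^sub>m Suc k * X s)"
        using Mk R MX W M X
        by (simp add: mult_add_distrib_mat[of _ K K _ m] mult_smult_distrib[of _ K K _ m]
            assoc_mult_mat[of _ K K _ K _ m])
      finally have "X s = V * Z s + ?d ^ k \<cdot>\<^sub>m (V * W + ?d \<cdot>\<^sub>m (M ^\<^sub>m Suc k * X s))"
        using elim(1) by simp
      also have "\<dots> = V * Z s + ?d ^ k \<cdot>\<^sub>m (V * W) + ?d ^ Suc k \<cdot>\<^sub>m (M ^\<^sub>m Suc k * X s)"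
        using V Z[of s] W(1) M X[of s] by (intro eq_matI) (auto simp: algebra_simps)
      also have "V * Z s + ?d ^ k \<cdot>\<^sub>m (V * W) = V * (Z s + ?d ^ k \<cdot>\<^sub>m W)"
        using V Z[of s] W(1)
        by (simp add: mult_add_distrib_mat[of _ K q _ m] mult_smult_distrib[of _ K q _ m])
      finally show ?case .
    qed
    then show ?case using Z W(1)
      by (intro exI[of _ "\<lambda>s. Z s + (complex_of_real s0 - s) ^ k \<cdot>\<^sub>m W"]) auto
  qed
  then obtain Z where Z: "\<And>s. Z s \<in> carrier_mat q m"
    and eq: "\<forall>\<^sub>F s in at (complex_of_real s0).
       X s = V * Z s + (complex_of_real s0 - s) ^ j \<cdot>\<^sub>m (M ^\<^sub>m j * X s)"
    by blast
  \<comment> \<open>The matrix factor of the remainder is bounded near s0, so the scalar factor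
    alone supplies order j.\<close>
  have "mat_bigo s0 0 K m (\<lambda>s. M ^\<^sub>m j * X s)"
    using mat_bigo_mult[OF mat_bigo_const[OF Mk] bX] by simp
  then have "mat_bigo s0 j K m (\<lambda>s. (complex_of_real s0 - s) ^ j \<cdot>\<^sub>m (M ^\<^sub>m j * X s))"
    by (rule mat_bigo_power_smult)
  then show ?thesis using Z eq unfolding X_def by blast
qed

section \<open>Error of the two-sided projection\<close>

text \<open>C need not be linear in s, and T is any bounded left inverse of the compressed matrix.
  The estimate therefore serves both the pencil of case (a) and the matrix polynomial of case (b),
  where T is a block of a larger resolvent.\<close>

lemma two_sided_projection_error:
  fixes C :: "complex \<Rightarrow> complex mat"
  assumes C: "mat_bigo s0 0 K K C"
    and V: "V \<in> carrier_mat K q" and B: "B \<in> carrier_mat K m"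
    and J: "J \<in> carrier_mat K K" and Jn: "Jn \<in> carrier_mat q q"
    and JV: "J * V = V * Jn" and JB: "J * B = B"
    and sym: "\<And>s. cadj (C s) * J = J * C (cnj s)"
    and Z: "\<And>s. Z s \<in> carrier_mat q m" and D: "mat_bigo s0 j K m \<Delta>"
    and sol: "\<forall>\<^sub>F s in at (complex_of_real s0). C s * (V * Z s + \<Delta> s) = B"
    and T: "mat_bigo s0 0 q q T"
    and inv: "\<forall>\<^sub>F s in at (complex_of_real s0). T s * (cadj V * C s * V) = 1\<^sub>m q"
  shows "\<exists>F. mat_bigo s0 (2 * j) m m F \<and> (\<forall>\<^sub>F s in at (complex_of_real s0).
    cadj B * (V * Z s + \<Delta> s) - cadj B * (V * (T s * (cadj V * B))) = F s)"
proof -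
  \<comment> \<open>The projection reproduces V Z, so X - X_n depends on \<Delta> alone; this closed
    form inherits the order j.\<close>
  define U where "U = (\<lambda>s. \<Delta> s - V * (T s * (cadj V * (C s * \<Delta> s))))"
  \<comment> \<open>The error X - X_n paired with the \<Delta> part of the left solution J X(cnj s);
    each of the two contributes order j.\<close>
  define F where "F = (\<lambda>s. cadj (\<Delta> (cnj s)) * (cadj J * (C s * U s)))"
  have VH: "cadj V \<in> carrier_mat q K" and JH: "cadj J \<in> carrier_mat K K" using V J by auto
  have CD: "mat_bigo s0 j K m (\<lambda>s. C s * \<Delta> s)" using mat_bigo_mult[OF C D] by simp
  have bU: "mat_bigo s0 j K m U"
    unfolding U_def
    using mat_bigo_mult[OF mat_bigo_const[OF V]
        mat_bigo_mult[OF T mat_bigo_mult[OF mat_bigo_const[OF VH] CD]]]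
    by (intro mat_bigo_minus D) simp
  have bF: "mat_bigo s0 (2 * j) m m F"
    unfolding F_def
    using mat_bigo_mult[OF mat_bigo_cadj_cnj[OF D]
        mat_bigo_mult[OF mat_bigo_const[OF JH] mat_bigo_mult[OF C bU]]]
    by (simp add: mult_2)
  have bs: "C s \<in> carrier_mat K K" "\<Delta> s \<in> carrier_mat K m" "T s \<in> carrier_mat q q"
    "U s \<in> carrier_mat K m" for s
    using C D T bU by (auto simp: mat_bigo_def)
  have dims [simp]: "dim_row (C s) = K" "dim_col (C s) = K" "dim_row (\<Delta> s) = K" "dim_col (\<Delta> s) = m"
    "dim_row (T s) = q" "dim_col (T s) = q" "dim_row V = K" "dim_col V = q"
    "dim_row B = K" "dim_col B = m" "dim_row J = K" "dim_col J = K" "dim_row Jn = q" "dim_col Jn = q"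
    "dim_row (Z s) = q" "dim_col (Z s) = m" "dim_row (U s) = K" "dim_col (U s) = m" for s
    using bs[of s] V B J Jn Z[of s] by (auto simp only: carrier_matD)
  have "\<forall>\<^sub>F s in at (complex_of_real s0). C (cnj s) * (V * Z (cnj s) + \<Delta> (cnj s)) = B"
    using eventually_compose_filterlim[OF sol filterlim_cnj_at_real] .
  with sol inv have "\<forall>\<^sub>F s in at (complex_of_real s0).
    cadj B * (V * Z s + \<Delta> s) - cadj B * (V * (T s * (cadj V * B))) = F s"
  proof eventually_elim
    case (elim s)
    define X where "X = V * Z s + \<Delta> s"
    define X' where "X' = V * Z (cnj s) + \<Delta> (cnj s)"
    define Xn where "Xn = V * (T s * (cadj V * B))"
    have dX [simp]: "dim_row X = K" "dim_col X = m" "dim_row X' = K" "dim_col X' = m"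
      "dim_row Xn = K" "dim_col Xn = m"
      by (auto simp: X_def X'_def Xn_def)
    have CX: "C s * X = B" and CX': "C (cnj s) * X' = B" using elim by (simp_all add: X_def X'_def)
    \<comment> \<open>For square matrices the left inverse is also a right inverse. The left
      identity recovers Z, the right one gives the Galerkin condition.\<close>
    have inv': "(cadj V * C s * V) * T s = 1\<^sub>m q"
      by (rule mat_mult_left_right_inverse[OF _ _ elim(2)]) (auto intro!: carrier_matI)
    have Xn: "Xn = V * (T s * (cadj V * (C s * X)))" by (simp add: Xn_def CX)
    have "T s * (cadj V * (C s * (V * Z s))) = (T s * (cadj V * C s * V)) * Z s"
      by (simp add: assoc_mult_mat_dim)
    also have "\<dots> = Z s" using Z[of s] by (simp add: elim(2))
    finally have "Xn = V * Z s + V * (T s * (cadj V * (C s * \<Delta> s)))"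
      unfolding Xn X_def by (simp add: mult_add_distrib_dim)
    then have XU: "X - Xn = U s"
      unfolding X_def U_def by (intro eq_matI) auto
    have "cadj V * (C s * Xn) = (cadj V * C s * V) * T s * (cadj V * B)"
      unfolding Xn_def by (simp add: assoc_mult_mat_dim)
    also have "\<dots> = cadj V * B" unfolding inv' using VH B by auto
    finally have "cadj V * (C s * (X - Xn)) = cadj V * B - cadj V * B"
      by (simp add: mult_minus_distrib_dim CX)
    also have "\<dots> = 0\<^sub>m q m" using VH B by (intro eq_matI) auto
    finally have orth: "cadj V * (C s * U s) = 0\<^sub>m q m" by (simp add: XU)
    \<comment> \<open>J X(cnj s) solves the adjoint equation C(s)^H Y = B, which lets B^H be written
      as Y^H C(s).\<close>
    have "cadj (C s) * (J * X') = (cadj (C s) * J) * X'" by (simp add: assoc_mult_mat_dim)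
    also have "\<dots> = J * (C (cnj s) * X')" unfolding sym by (simp add: assoc_mult_mat_dim)
    finally have "cadj B = cadj (cadj (C s) * (J * X'))" by (simp add: CX' JB)
    also have "\<dots> = cadj (J * X') * C s"
      by (subst cadj_mult[of _ K K _ m]) (auto intro!: carrier_matI)
    finally have BH: "cadj B = cadj (J * X') * C s" .
    \<comment> \<open>J maps the range of V into itself, so the V part of the left solution stays
      there and the Galerkin condition annihilates it; only the \<Delta> part survives.\<close>
    have "J * (V * Z (cnj s)) = (J * V) * Z (cnj s)" by (simp add: assoc_mult_mat_dim)
    then have "J * X' = V * (Jn * Z (cnj s)) + J * \<Delta> (cnj s)"
      unfolding X'_def JV by (simp add: mult_add_distrib_dim assoc_mult_mat_dim)
    then have JX: "cadj (J * X') = cadj (Jn * Z (cnj s)) * cadj V + cadj (\<Delta> (cnj s)) * cadj J"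
      by (simp add: cadj_add[of _ K m] cadj_mult[of V K q _ m] cadj_mult[of J K K _ m] carrier_matI)
    have "cadj B * X - cadj B * Xn = cadj B * U s"
      by (simp add: mult_minus_distrib_dim flip: XU)
    also have "\<dots> = cadj (Jn * Z (cnj s)) * (cadj V * (C s * U s)) + F s"
      unfolding BH JX F_def by (simp add: assoc_mult_mat_dim add_mult_distrib_dim)
    also have "\<dots> = F s"
      unfolding orth using mat_bigo_carrier[OF bF, of s] Z[of "cnj s"] Jn by auto
    finally show ?case by (simp add: X_def Xn_def)
  qed
  then show ?thesis using bF by blast
qed

text \<open>The feedthrough D cancels in the difference, and an identity valid near s0 suffices for
  an order bound. F is original minus reduced, hence a change of sign in the proof.\<close>

lemma bigo_entry_of_eventually:
  assumes F: "mat_bigo s0 p m m F" and D: "D \<in> carrier_mat m m"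
    and P: "\<And>s. P s \<in> carrier_mat m m" and Q: "\<And>s. Q s \<in> carrier_mat m m"
    and H: "\<And>s. H s = D + P s" and Hn: "\<And>s. Hn s = D + Q s"
    and ev: "\<forall>\<^sub>F s in at (complex_of_real s0). P s - Q s = F s"
    and a: "a < m" and b: "b < m"
  shows "(\<lambda>s. Hn s $$ (a,b) - H s $$ (a,b)) \<in> O[at (complex_of_real s0)](\<lambda>s. (s - complex_of_real s0) ^ p)"
proof -
  have "\<forall>\<^sub>F s in at (complex_of_real s0). Hn s $$ (a,b) - H s $$ (a,b) = - F s $$ (a,b)"
    using ev
  proof eventually_elim
    case (elim s)
    have "(P s - Q s) $$ (a,b) = F s $$ (a,b)" using elim by simp
    then show ?case using P[of s] Q[of s] D a b by (simp add: H Hn algebra_simps)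
  qed
  moreover have "(\<lambda>s. - F s $$ (a,b)) \<in> O[at (complex_of_real s0)](\<lambda>s. (s - complex_of_real s0) ^ p)"
    using F a b by (simp add: mat_bigo_def)
  ultimately show ?thesis by (simp add: landau_o.big.in_cong)
qed

lemma projected_pencil:
  fixes E A V :: "complex mat"
  assumes "E \<in> carrier_mat K K" "A \<in> carrier_mat K K" "V \<in> carrier_mat K q"
  shows "s \<cdot>\<^sub>m (cadj V * E * V) - cadj V * A * V = cadj V * (s \<cdot>\<^sub>m E - A) * V"
proof -
  have EV: "E * V \<in> carrier_mat K q" and AV: "A * V \<in> carrier_mat K q" and VH: "cadj V \<in> carrier_mat q K"
    using assms by auto
  have "cadj V * (s \<cdot>\<^sub>m E - A) * V = cadj V * ((s \<cdot>\<^sub>m E - A) * V)"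
    using assms by (simp add: assoc_mult_mat_dim)
  also have "(s \<cdot>\<^sub>m E - A) * V = s \<cdot>\<^sub>m (E * V) - A * V"
    using assms by (simp add: minus_mult_distrib_dim mult_smult_assoc_mat[of _ K K _ q])
  also have "cadj V * \<dots> = s \<cdot>\<^sub>m (cadj V * (E * V)) - cadj V * (A * V)"
    using carrier_matD[OF EV] carrier_matD[OF AV] carrier_matD[OF VH] mult_smult_distrib[OF VH EV]
    by (simp add: mult_minus_distrib_dim del: index_mult_mat)
  finally show ?thesis using assms by (simp add: assoc_mult_mat_dim)
qed

text \<open>The estimate for C(s) = sE - A with T the reduced resolvent. The relations of J with E
  and with A combine to C(s)^H J = J C(cnj s), because the adjoint conjugates the scalar s.\<close>

lemma moment_match_signature_symmetric:
  fixes E A :: "complex mat"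
  assumes E: "E \<in> carrier_mat K K" and A: "A \<in> carrier_mat K K" and B: "B \<in> carrier_mat K m"
    and D: "D \<in> carrier_mat m m" and V: "V \<in> carrier_mat K q"
    and J: "J \<in> carrier_mat K K" and Jn: "Jn \<in> carrier_mat q q"
    and JV: "J * V = V * Jn" and JB: "J * B = B"
    and JE: "cadj E * J = J * E" and JA: "cadj A * J = J * A"
    and det: "det (complex_of_real s0 \<cdot>\<^sub>m E - A) \<noteq> 0"
    and detn: "det (complex_of_real s0 \<cdot>\<^sub>m (cadj V * E * V) - cadj V * A * V) \<noteq> 0"
    and sub: "krylov_space (Mmat E A s0) (Rmat E A B s0) j \<subseteq> col_space V"
    and ab: "a < m" "b < m"
  shows "(\<lambda>s. transfer (cadj V * E * V) (cadj V * A * V) (cadj V * B) (cadj B * V) D s $$ (a,b)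
      - transfer E A B (cadj B) D s $$ (a,b))
    \<in> O[at (complex_of_real s0)](\<lambda>s. (s - complex_of_real s0) ^ (2 * j))"
proof -
  define En where "En = cadj V * E * V"
  define An where "An = cadj V * A * V"
  have En: "En \<in> carrier_mat q q" and An: "An \<in> carrier_mat q q"
    using V E A by (auto simp: En_def An_def intro!: mult_carrier_mat)
  have C: "s \<cdot>\<^sub>m E - A \<in> carrier_mat K K" and Cn: "s \<cdot>\<^sub>m En - An \<in> carrier_mat q q" for s
    using A An by auto
  obtain Z \<Delta> where Z: "\<And>s. Z s \<in> carrier_mat q m" and \<Delta>: "mat_bigo s0 j K m \<Delta>"
    and X: "\<forall>\<^sub>F s in at (complex_of_real s0). minv (s \<cdot>\<^sub>m E - A) * B = V * Z s + \<Delta> s"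
    using resolvent_krylov_expansion[OF E A B V det sub] by blast
  have bC: "mat_bigo s0 0 K K (\<lambda>s. s \<cdot>\<^sub>m E - A)"
    using C pencil_entry_isCont[OF E A] by (intro mat_bigo_cont) auto
  have sym: "cadj (s \<cdot>\<^sub>m E - A) * J = J * (cnj s \<cdot>\<^sub>m E - A)" for s
  proof -
    have "cadj (s \<cdot>\<^sub>m E - A) * J = cnj s \<cdot>\<^sub>m (cadj E * J) - cadj A * J"
      using E A J by (simp add: cadj_minus[of _ K K] cadj_smult minus_mult_distrib_mat[of _ K K]
          mult_smult_assoc_mat[of _ K K _ K])
    also have "\<dots> = J * (cnj s \<cdot>\<^sub>m E - A)"
      using E A J by (simp add: JE JA mult_minus_distrib_mat[of _ K K _ K] mult_smult_distrib[of _ K K _ K])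
    finally show ?thesis .
  qed
  have sol: "\<forall>\<^sub>F s in at (complex_of_real s0). (s \<cdot>\<^sub>m E - A) * (V * Z s + \<Delta> s) = B"
    using X pencil_nonsingular_eventually[OF E A det]
  proof eventually_elim
    case (elim s)
    have "(s \<cdot>\<^sub>m E - A) * (minv (s \<cdot>\<^sub>m E - A) * B) = B"
      using minv_inverse(1)[OF C elim(2)] C[of s] B minv_carrier[OF C[of s]]
      by (simp flip: assoc_mult_mat[of _ K K _ K _ m])
    then show ?case using elim by simp
  qed
  have inv: "\<forall>\<^sub>F s in at (complex_of_real s0).
      minv (s \<cdot>\<^sub>m En - An) * (cadj V * (s \<cdot>\<^sub>m E - A) * V) = 1\<^sub>m q"
    using pencil_nonsingular_eventually[OF En An detn[folded En_def An_def]]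
  proof eventually_elim
    case (elim s)
    then show ?case
      using minv_inverse(2)[OF Cn elim] by (simp add: En_def An_def projected_pencil[OF E A V])
  qed
  obtain F where F: "mat_bigo s0 (2 * j) m m F"
    and ev: "\<forall>\<^sub>F s in at (complex_of_real s0). cadj B * (V * Z s + \<Delta> s)
      - cadj B * (V * (minv (s \<cdot>\<^sub>m En - An) * (cadj V * B))) = F s"
    using two_sided_projection_error[OF bC V B J Jn JV JB sym Z \<Delta> sol
        mat_bigo_resolvent[OF En An detn[folded En_def An_def]] inv] by blast
  have mc: "minv (s \<cdot>\<^sub>m E - A) \<in> carrier_mat K K" "minv (s \<cdot>\<^sub>m En - An) \<in> carrier_mat q q" for s
    using C Cn by auto
  note cs = carrier_matD[OF mc(1)] carrier_matD[OF mc(2)] carrier_matD[OF B] carrier_matD[OF V]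
  have "(\<lambda>s. transfer En An (cadj V * B) (cadj B * V) D s $$ (a,b)
      - transfer E A B (cadj B) D s $$ (a,b))
    \<in> O[at (complex_of_real s0)](\<lambda>s. (s - complex_of_real s0) ^ (2 * j))"
  proof (rule bigo_entry_of_eventually[OF F D _ _ _ _ _ ab])
    show "cadj B * (minv (s \<cdot>\<^sub>m E - A) * B) \<in> carrier_mat m m"
      "cadj B * (V * (minv (s \<cdot>\<^sub>m En - An) * (cadj V * B))) \<in> carrier_mat m m" for s
      by (intro carrier_matI; simp add: cs)+
    show "transfer E A B (cadj B) D s = D + cadj B * (minv (s \<cdot>\<^sub>m E - A) * B)" for s
      by (simp add: transfer_def assoc_mult_mat_dim cs)
    show "transfer En An (cadj V * B) (cadj B * V) D s
        = D + cadj B * (V * (minv (s \<cdot>\<^sub>m En - An) * (cadj V * B)))" for s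
      by (simp add: transfer_def assoc_mult_mat_dim cs)
    show "\<forall>\<^sub>F s in at (complex_of_real s0). cadj B * (minv (s \<cdot>\<^sub>m E - A) * B)
        - cadj B * (V * (minv (s \<cdot>\<^sub>m En - An) * (cadj V * B))) = F s"
      using ev X by eventually_elim simp
  qed
  then show ?thesis by (simp add: En_def An_def)
qed

section \<open>Special second-order systems\<close>

text \<open>Common form of both variants of case (a). The off-diagonal blocks of A are negative
  adjoints of each other, and the signature diag(I, -I) compensates exactly this sign.\<close>

lemma moment_match_special_second_order:
  assumes P0: "P0 \<in> carrier_mat N N" "hermitian_mat P0" and P1: "P1 \<in> carrier_mat N N" "hermitian_mat P1"
    and G: "G \<in> carrier_mat N0 N0" "hermitian_mat G" and F: "F \<in> carrier_mat N N0"
    and B: "B \<in> carrier_mat N m" and D: "D \<in> carrier_mat m m"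
    and A_def: "A = four_block_mat (- P0) (- F) (cadj F) (0\<^sub>m N0 N0)"
    and E_def: "E = blkdiag2 P1 G"
    and Bf_def: "Bf = B @\<^sub>r 0\<^sub>m N0 m"
    and Lf_def: "Lf = four_block_mat (cadj B) (0\<^sub>m m N0) (0\<^sub>m 0 N) (0\<^sub>m 0 N0)"
    and proj: "proj_a N N0 G' (krylov_space (Mmat E A s0) (Rmat E A Bf s0) j) V"
    and det: "det (complex_of_real s0 \<cdot>\<^sub>m E - A) \<noteq> 0"
    and detn: "det (complex_of_real s0 \<cdot>\<^sub>m (cadj V * E * V) - cadj V * A * V) \<noteq> 0"
    and ab: "a < m" "b < m"
  shows "(\<lambda>s. transfer (cadj V * E * V) (cadj V * A * V) (cadj V * Bf) (Lf * V) D s $$ (a,b)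
      - transfer E A Bf Lf D s $$ (a,b))
    \<in> O[at (complex_of_real s0)](\<lambda>s. (s - complex_of_real s0) ^ (2 * j))"
proof -
  obtain V1 V2 q where V1: "V1 \<in> carrier_mat N q" and V2: "V2 \<in> carrier_mat N0 q"
    and cs: "col_space (V1 @\<^sub>r V2) = krylov_space (Mmat E A s0) (Rmat E A Bf s0) j"
    and V_eq: "V = four_block_mat V1 (0\<^sub>m N q) (0\<^sub>m N0 q) V2"
    using proj by (auto simp: proj_a_def blkdiag2_def)
  \<comment> \<open>Two sizes occur: \<open>J N N0\<close> acts on the state space,
    \<open>J q q\<close> is the induced signature on the coefficients of V = diag(V1, V2).\<close>
  define J where "J = (\<lambda>p r. four_block_mat (1\<^sub>m p) (0\<^sub>m p r) (0\<^sub>m r p) (- 1\<^sub>m r :: complex mat))"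
  have J: "J p r \<in> carrier_mat (p + r) (p + r)" for p r by (auto simp: J_def)
  have E_eq: "E = four_block_mat P1 (0\<^sub>m N N0) (0\<^sub>m N0 N) G"
    using P1 G by (simp add: E_def blkdiag2_def)
  have E: "E \<in> carrier_mat (N + N0) (N + N0)" and A: "A \<in> carrier_mat (N + N0) (N + N0)"
    and Bf: "Bf \<in> carrier_mat (N + N0) m" and V: "V \<in> carrier_mat (N + N0) (q + q)"
    using P0 P1 G F B V1 V2 by (auto simp: E_eq A_def Bf_def V_eq)
  have herm: "cadj P0 = P0" "cadj P1 = P1" "cadj G = G"
    using P0 P1 G by (auto simp: hermitian_mat_def)
  have JV: "J N N0 * V = V * J q q"
    unfolding J_def V_eq using V1 V2
    by (subst (1 2) mult_four_block_mat[where ?nr1.0 = N and ?nr2.0 = N0]) auto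
  \<comment> \<open>The signature changes signs only in the lower block, where \<open>Bf\<close> is
    zero. The appended rows unfold to a four-block matrix whose right block column has width
    0.\<close>
  have JB: "J N N0 * Bf = Bf"
    unfolding J_def Bf_def append_rows_def using B
    by (subst mult_four_block_mat[where ?nr1.0 = N and ?nr2.0 = N0 and ?n1.0 = N and ?n2.0 = N0
          and ?nc1.0 = m and ?nc2.0 = 0]) auto
  have uminus_zero [simp]: "- 0\<^sub>m n k = (0\<^sub>m n k :: complex mat)" for n k
    by (intro eq_matI) auto
  have JE: "cadj E * J N N0 = J N N0 * E"
    unfolding J_def E_eq using P1 G
    by (simp add: cadj_four_block_mat[of _ N N _ N0 _ N0] herm
        mult_four_block_mat[of _ N N _ N0 _ N0 _ _ N _ N0])
  have JA: "cadj A * J N N0 = J N N0 * A"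
    unfolding J_def A_def using P0 F
    by (simp add: cadj_four_block_mat[of _ N N _ N0 _ N0] herm cadj_uminus
        mult_four_block_mat[of _ N N _ N0 _ N0 _ _ N _ N0])
  \<comment> \<open>The stacked identities add the upper and lower half of each column together
    again, so splitting the basis can only enlarge its range.\<close>
  have "V1 @\<^sub>r V2 = V * (1\<^sub>m q @\<^sub>r 1\<^sub>m q)"
    unfolding append_rows_def V_eq using V1 V2
    by (subst mult_four_block_mat[where ?nr1.0 = N and ?nr2.0 = N0 and ?n1.0 = q and ?n2.0 = q
          and ?nc1.0 = q and ?nc2.0 = 0]) auto
  then have sub: "krylov_space (Mmat E A s0) (Rmat E A Bf s0) j \<subseteq> col_space V"
    using col_space_mult_subset[OF V, of "1\<^sub>m q @\<^sub>r 1\<^sub>m q" q] cs by auto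
  have "Lf = cadj Bf"
    using B by (intro eq_matI) (auto simp: Lf_def Bf_def append_rows_def)
  then show ?thesis
    using moment_match_signature_symmetric[OF E A Bf D V J J JV JB JE JA det detn sub ab] by simp
qed

section \<open>Higher-order systems\<close>

text \<open>The Kronecker product of the column vector f (0), ..., f (l-1) with the identity of size N.\<close>

definition kron_col :: "nat \<Rightarrow> nat \<Rightarrow> (nat \<Rightarrow> complex) \<Rightarrow> complex mat" where
  "kron_col N l f = mat (l * N) N (\<lambda>(r,c). if r mod N = c then f (r div N) else 0)"

text \<open>The Kronecker product of the identity of size l with S, that is, the projection matrix
  diag(S, ..., S) of case (b).\<close>

definition kron_id :: "nat \<Rightarrow> complex mat \<Rightarrow> complex mat" where
  "kron_id l S = mat (l * dim_row S) (l * dim_col S)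
     (\<lambda>(r,c). if r div dim_row S = c div dim_col S then S $$ (r mod dim_row S, c mod dim_col S) else 0)"

lemma kron_col_carrier [simp]: "kron_col N l f \<in> carrier_mat (l * N) N"
  by (simp add: kron_col_def)

lemma dim_kron_col [simp]: "dim_row (kron_col N l f) = l * N" "dim_col (kron_col N l f) = N"
  by (simp_all add: kron_col_def)

lemma kron_id_carrier: "S \<in> carrier_mat N n \<Longrightarrow> kron_id l S \<in> carrier_mat (l * N) (l * n)"
  by (auto simp: kron_id_def)

lemma block_index_less:
  fixes N :: nat
  assumes "b < l" "c < N"
  shows "b * N + c < l * N"
proof -
  have "b * N + c < Suc b * N" using assms by simp
  also have "\<dots> \<le> l * N" using assms by (intro mult_le_mono1) simp
  finally show ?thesis .
qed

text \<open>The indices below l N with residue c are b N + c, one for each block b < l. This turns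
  an inner product with a column of \<open>kron_col\<close> into a sum over blocks.\<close>

lemma sum_residue_class:
  fixes g :: "nat \<Rightarrow> complex"
  assumes c: "c < N"
  shows "(\<Sum>k = 0..<l * N. if k mod N = c then g k else 0) = (\<Sum>b<l. g (b * N + c))"
proof -
  have "(\<Sum>k = 0..<l * N. if k mod N = c then g k else 0) = (\<Sum>k \<in> {k \<in> {0..<l * N}. k mod N = c}. g k)"
    by (rule sum.inter_filter[symmetric]) simp
  also have "\<dots> = (\<Sum>b<l. g (b * N + c))"
    using c block_index_less[of _ l c N]
    by (intro sum.reindex_bij_witness[of _ "\<lambda>b. b * N + c" "\<lambda>k. k div N"])
      (auto simp: less_mult_imp_div_less)
  finally show ?thesis .
qed

lemma mult_kron_col_index:
  assumes "M \<in> carrier_mat p (l * N)" "r < p" "c < N"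
  shows "(M * kron_col N l f) $$ (r,c) = (\<Sum>b<l. M $$ (r, b * N + c) * f b)"
proof -
  have "(M * kron_col N l f) $$ (r,c)
      = (\<Sum>k = 0..<l * N. if k mod N = c then M $$ (r,k) * f (k div N) else 0)"
    using assms by (auto simp: scalar_prod_def kron_col_def intro!: sum.cong)
  then show ?thesis using assms by (simp add: sum_residue_class)
qed

lemma kron_col_mult_index:
  assumes M: "M \<in> carrier_mat N p" and r: "r < l * N" and c: "c < p"
  shows "(kron_col N l f * M) $$ (r,c) = f (r div N) * M $$ (r mod N, c)"
proof -
  \<comment> \<open>The bound on r excludes N = 0, for which r mod N would be r.\<close>
  have lt: "r mod N < N" using r by (intro mod_less_divisor) (cases N; simp)
  have "(kron_col N l f * M) $$ (r,c)
      = (\<Sum>k = 0..<N. (if r mod N = k then f (r div N) else 0) * M $$ (k,c))"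
    using assms by (simp add: scalar_prod_def kron_col_def)
  also have "\<dots> = (\<Sum>k = 0..<N. if k = r mod N then f (r div N) * M $$ (k,c) else 0)"
    by (intro sum.cong) auto
  also have "\<dots> = f (r div N) * M $$ (r mod N, c)" using lt by simp
  finally show ?thesis .
qed

text \<open>Mixed-product rule: both sides are the Kronecker product of f with S. It moves the
  projection past block columns.\<close>

lemma kron_id_mult_kron_col:
  assumes S: "S \<in> carrier_mat N n"
  shows "kron_id l S * kron_col n l f = kron_col N l f * S"
proof (rule eq_matI)
  fix r c assume "r < dim_row (kron_col N l f * S)" "c < dim_col (kron_col N l f * S)"
  then have rc: "r < l * N" "c < n" using S by auto
  have "(kron_id l S * kron_col n l f) $$ (r,c) = (\<Sum>b<l. kron_id l S $$ (r, b * n + c) * f b)"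
    using kron_id_carrier[OF S] rc by (rule mult_kron_col_index)
  also have "\<dots> = (\<Sum>b<l. if b = r div N then f (r div N) * S $$ (r mod N, c) else 0)"
    using S rc block_index_less[of _ l c n] by (intro sum.cong) (auto simp: kron_id_def)
  also have "\<dots> = (kron_col N l f * S) $$ (r,c)"
    using rc S kron_col_mult_index[OF S rc, of f] by (simp add: less_mult_imp_div_less)
  finally show "(kron_id l S * kron_col n l f) $$ (r,c) = (kron_col N l f * S) $$ (r,c)" .
qed (use S kron_id_carrier[OF S, of l] in auto)

lemma cadj_kron_id: "cadj (kron_id l S) = kron_id l (cadj S)"
proof (rule eq_matI)
  fix r c assume "r < dim_row (kron_id l (cadj S))" "c < dim_col (kron_id l (cadj S))"
  then have rc: "r < l * dim_col S" "c < l * dim_row S" by (auto simp: kron_id_def)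
  then have "r mod dim_col S < dim_col S" "c mod dim_row S < dim_row S"
    by (metis mod_less_divisor mult_0_right not_gr_zero not_less_zero)+
  then show "cadj (kron_id l S) $$ (r,c) = kron_id l (cadj S) $$ (r,c)"
    using rc by (auto simp: kron_id_def)
qed (auto simp: kron_id_def)

lemma cadj_kron_col_mult_kron_col:
  assumes l: "1 \<le> l" and g: "g 0 = 1"
  shows "cadj (kron_col N l (\<lambda>i. if i = 0 then 1 else 0)) * kron_col N l g = 1\<^sub>m N"
proof (rule eq_matI)
  fix r c assume "r < dim_row (1\<^sub>m N :: complex mat)" "c < dim_col (1\<^sub>m N :: complex mat)"
  then have rc: "r < N" "c < N" by auto
  let ?e = "kron_col N l (\<lambda>i. if i = 0 then 1 else 0)"
  have "(cadj ?e * kron_col N l g) $$ (r,c) = (\<Sum>b<l. cadj ?e $$ (r, b * N + c) * g b)"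
    using rc by (intro mult_kron_col_index[of _ N]) auto
  also have "\<dots> = (\<Sum>b<l. if b = 0 then (if r = c then 1 else 0) else 0)"
    using rc g block_index_less[of _ l c N] by (intro sum.cong) (auto simp: kron_col_def)
  also have "\<dots> = 1\<^sub>m N $$ (r,c)" using l rc by auto
  finally show "(cadj ?e * kron_col N l g) $$ (r,c) = 1\<^sub>m N $$ (r,c)" .
qed auto

text \<open>Defined entrywise, so that the size is immediate and continuity and adjoints reduce to
  scalar polynomials.\<close>

definition mat_poly :: "nat \<Rightarrow> nat \<Rightarrow> (nat \<Rightarrow> complex mat) \<Rightarrow> complex \<Rightarrow> complex mat" where
  "mat_poly N l P s = mat N N (\<lambda>(i,k). \<Sum>t\<le>l. s ^ t * P t $$ (i,k))"

lemma mat_poly_carrier [simp]: "mat_poly N l P s \<in> carrier_mat N N"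
  by (simp add: mat_poly_def)

text \<open>Applied to the block column I, sI, ..., s^(l-1) I, every block row but the last cancels,
  and the last one collects all terms of P(s).\<close>

lemma companion_mult_power_col:
  assumes l: "1 \<le> l"
    and E_def: "E = mat (l*N) (l*N) (\<lambda>(r,c). if r div N = c div N then
            (if r div N = l - 1 then P l $$ (r mod N, c mod N) else (if r mod N = c mod N then 1 else 0))
          else 0)"
    and A_def: "A = mat (l*N) (l*N) (\<lambda>(r,c).
            if r div N = l - 1 then - (P (c div N) $$ (r mod N, c mod N))
            else if c div N = r div N + 1 \<and> r mod N = c mod N then 1 else 0)"
  shows "(s \<cdot>\<^sub>m E - A) * kron_col N l (\<lambda>i. s ^ i)
    = kron_col N l (\<lambda>i. if i = l - 1 then 1 else 0) * mat_poly N l P s"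
proof (rule eq_matI)
  let ?R = "kron_col N l (\<lambda>i. if i = l - 1 then 1 else 0) * mat_poly N l P s"
  fix r c assume "r < dim_row ?R" "c < dim_col ?R"
  then have rc: "r < l * N" "c < N" by (auto simp: mat_poly_def)
  have i: "r mod N < N" using rc by simp
  have d: "r div N < l" using rc by (simp add: less_mult_imp_div_less)
  have C: "s \<cdot>\<^sub>m E - A \<in> carrier_mat (l * N) (l * N)"
    unfolding A_def by (intro minus_carrier_mat mat_carrier)
  \<comment> \<open>In the last block row the contributions s P_l and P_(l-1) meet at b = l - 1; for
    l = 1 this is the only block.\<close>
  have entry: "(s \<cdot>\<^sub>m E - A) $$ (r, b * N + c)
      = (if r div N = l - 1 then (if b = l - 1 then s * P l $$ (r mod N, c) else 0) + P b $$ (r mod N, c)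
         else if r mod N = c then (if b = r div N then s else 0) - (if b = Suc (r div N) then 1 else 0)
         else 0)" if "b < l" for b
    using rc block_index_less[OF that rc(2)] by (auto simp: E_def A_def)
  have "((s \<cdot>\<^sub>m E - A) * kron_col N l (\<lambda>i. s ^ i)) $$ (r,c)
      = (\<Sum>b<l. (s \<cdot>\<^sub>m E - A) $$ (r, b * N + c) * s ^ b)"
    using C rc by (rule mult_kron_col_index)
  also have "\<dots> = (if r div N = l - 1 then 1 else 0) * mat_poly N l P s $$ (r mod N, c)"
  proof (cases "r div N = l - 1")
    case True
    have "(\<Sum>b<l. (s \<cdot>\<^sub>m E - A) $$ (r, b * N + c) * s ^ b)
        = (\<Sum>b<l. (if b = l - 1 then s * P l $$ (r mod N, c) * s ^ (l - 1) else 0)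
              + s ^ b * P b $$ (r mod N, c))"
    proof (intro sum.cong refl)
      fix b assume "b \<in> {..<l}"
      then have b: "b < l" by simp
      show "(s \<cdot>\<^sub>m E - A) $$ (r, b * N + c) * s ^ b
          = (if b = l - 1 then s * P l $$ (r mod N, c) * s ^ (l - 1) else 0) + s ^ b * P b $$ (r mod N, c)"
        unfolding entry[OF b] using True by (auto simp: algebra_simps)
    qed
    also have "\<dots> = s * P l $$ (r mod N, c) * s ^ (l - 1) + (\<Sum>b<l. s ^ b * P b $$ (r mod N, c))"
      using l by (simp add: sum.distrib)
    also have "s * P l $$ (r mod N, c) * s ^ (l - 1) = s ^ l * P l $$ (r mod N, c)"
      using l by (simp add: power_eq_if)
    finally show ?thesis
      using True rc i by (simp add: mat_poly_def flip: lessThan_Suc_atMost)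
  next
    case False
    then have d': "Suc (r div N) < l" using d by simp
    \<comment> \<open>In block row i, the diagonal block gives s times s^i and the superdiagonal
      block subtracts s^(i+1); the latter exists because i is not the last block.\<close>
    have "(\<Sum>b<l. (s \<cdot>\<^sub>m E - A) $$ (r, b * N + c) * s ^ b)
        = (\<Sum>b<l. (if b = r div N then (if r mod N = c then s ^ Suc (r div N) else 0) else 0)
              - (if b = Suc (r div N) then (if r mod N = c then s ^ Suc (r div N) else 0) else 0))"
      using False by (intro sum.cong) (auto simp: entry)
    also have "\<dots> = 0" using d d' by (simp add: sum_subtractf)
    finally show ?thesis using False by simp
  qed
  also have "\<dots> = ?R $$ (r,c)" using rc by (simp add: kron_col_mult_index[where p = N])
  finally show "((s \<cdot>\<^sub>m E - A) * kron_col N l (\<lambda>i. s ^ i)) $$ (r,c) = ?R $$ (r,c)" .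
qed (auto simp: A_def mat_poly_def)

text \<open>The input enters the last block row and the output reads the first, so each transfer
  function sees a single corner block of its resolvent. This lowers the problem from the pencil of
  size l N to the polynomial P(s) of size N.\<close>

lemma moment_match_higher_order:
  assumes l: "1 \<le> l" and P: "\<And>i. i \<le> l \<Longrightarrow> P i \<in> carrier_mat N N" "\<And>i. i \<le> l \<Longrightarrow> hermitian_mat (P i)"
    and B: "B \<in> carrier_mat N m" and D: "D \<in> carrier_mat m m"
    and E_def: "E = mat (l*N) (l*N) (\<lambda>(r,c). if r div N = c div N then
            (if r div N = l - 1 then P l $$ (r mod N, c mod N) else (if r mod N = c mod N then 1 else 0))
          else 0)"
    and A_def: "A = mat (l*N) (l*N) (\<lambda>(r,c).
            if r div N = l - 1 then - (P (c div N) $$ (r mod N, c mod N))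
            else if c div N = r div N + 1 \<and> r mod N = c mod N then 1 else 0)"
    and Bf_def: "Bf = mat (l*N) m (\<lambda>(r,c). if r div N = l - 1 then B $$ (r mod N, c) else 0)"
    and Lf_def: "Lf = mat m (l*N) (\<lambda>(r,c). if c div N = 0 then cnj (B $$ (c mod N, r)) else 0)"
    and proj: "proj_b N l n (krylov_space (Mmat E A s0) (Rmat E A Bf s0) j) V"
    and det: "det (complex_of_real s0 \<cdot>\<^sub>m E - A) \<noteq> 0"
    and detn: "det (complex_of_real s0 \<cdot>\<^sub>m (cadj V * E * V) - cadj V * A * V) \<noteq> 0"
    and ab: "a < m" "b < m"
  shows "(\<lambda>s. transfer (cadj V * E * V) (cadj V * A * V) (cadj V * Bf) (Lf * V) D s $$ (a,b)
      - transfer E A Bf Lf D s $$ (a,b))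
    \<in> O[at (complex_of_real s0)](\<lambda>s. (s - complex_of_real s0) ^ (2 * j))"
proof -
  obtain S where S: "S \<in> carrier_mat N n"
    and V_mat: "V = mat (l*N) (l*n) (\<lambda>(r,c). if r div N = c div n then S $$ (r mod N, c mod n) else 0)"
    and sub: "krylov_space (Mmat E A s0) (Rmat E A Bf s0) j \<subseteq> col_space V"
    using proj by (auto simp: proj_b_def)
  have V_eq: "V = kron_id l S" unfolding V_mat kron_id_def carrier_matD[OF S] ..
  define first where "first = (\<lambda>i::nat. if i = 0 then 1 else 0 :: complex)"
  define last where "last = (\<lambda>i. if i = l - 1 then 1 else 0 :: complex)"
  define e1 where "e1 = (\<lambda>p. kron_col p l first)"
  define el where "el = (\<lambda>p. kron_col p l last)"
  define U where "U = (\<lambda>p s. kron_col p l (\<lambda>i. s ^ i))"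
  define En where "En = cadj V * E * V"
  define An where "An = cadj V * A * V"
  \<comment> \<open>The corner blocks of the full and the reduced resolvent; near s0 they invert
    P(s) and S^H P(s) S.\<close>
  define T where "T = (\<lambda>s. cadj (e1 N) * (minv (s \<cdot>\<^sub>m E - A) * el N))"
  define Tn where "Tn = (\<lambda>s. cadj (e1 n) * (minv (s \<cdot>\<^sub>m En - An) * el n))"
  let ?P = "mat_poly N l P"
  have V: "V \<in> carrier_mat (l * N) (l * n)" unfolding V_eq using S by (rule kron_id_carrier)
  have E: "E \<in> carrier_mat (l * N) (l * N)" and A: "A \<in> carrier_mat (l * N) (l * N)"
    and Bf: "Bf \<in> carrier_mat (l * N) m"
    by (simp_all add: E_def A_def Bf_def)
  have En: "En \<in> carrier_mat (l * n) (l * n)" and An: "An \<in> carrier_mat (l * n) (l * n)"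
    using V E A by (auto simp: En_def An_def intro!: mult_carrier_mat)
  have C: "s \<cdot>\<^sub>m E - A \<in> carrier_mat (l * N) (l * N)"
    and Cn: "s \<cdot>\<^sub>m En - An \<in> carrier_mat (l * n) (l * n)" for s
    using A An by auto
  note mc = minv_carrier[OF C] minv_carrier[OF Cn]
  have kc: "e1 p \<in> carrier_mat (l * p) p" "el p \<in> carrier_mat (l * p) p" "U p s \<in> carrier_mat (l * p) p"
    for p s by (simp_all add: e1_def el_def U_def)
  note dims = carrier_matD[OF mc(1)] carrier_matD[OF mc(2)] carrier_matD[OF kc(1)]
    carrier_matD[OF kc(2)] carrier_matD[OF kc(3)] carrier_matD[OF S] carrier_matD[OF V]
    carrier_matD[OF B] carrier_matD[OF mat_poly_carrier] carrier_matD[OF C] carrier_matD[OF Cn]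
  have Bf_eq: "Bf = el N * B"
    by (rule eq_matI)
      (use B in \<open>auto simp: Bf_def el_def last_def kron_col_mult_index simp del: index_mult_mat(1)\<close>)
  have "cadj Lf = e1 N * B"
    by (rule eq_matI)
      (use B in \<open>auto simp: Lf_def e1_def first_def kron_col_mult_index simp del: index_mult_mat(1)\<close>)
  then have "Lf = cadj (e1 N * B)" by (metis cadj_cadj)
  then have Lf_eq: "Lf = cadj B * cadj (e1 N)" using cadj_mult[OF kc(1) B] by simp
  have VU: "V * U n s = U N s * S" for s
    unfolding V_eq U_def using S by (rule kron_id_mult_kron_col)
  have Vel: "cadj V * el N = el n * cadj S" and Ve1: "cadj V * e1 N = e1 n * cadj S"
    unfolding V_eq cadj_kron_id el_def e1_def using S by (intro kron_id_mult_kron_col; auto)+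
  have e1V: "cadj (e1 N) * V = S * cadj (e1 n)"
  proof -
    have "cadj (e1 N) * V = cadj (cadj V * e1 N)"
      using cadj_mult[OF cadj_carrier[OF V] kc(1)] by simp
    also have "\<dots> = S * cadj (e1 n)"
      unfolding Ve1 using cadj_mult[OF kc(1) cadj_carrier[OF S]] by simp
    finally show ?thesis .
  qed
  have e1U: "cadj (e1 p) * U p s = 1\<^sub>m p" for p s
    unfolding e1_def U_def first_def using l by (intro cadj_kron_col_mult_kron_col) auto
  have CU: "(s \<cdot>\<^sub>m E - A) * U N s = el N * ?P s" for s
    unfolding U_def el_def last_def using l E_def A_def by (rule companion_mult_power_col)
  \<comment> \<open>The companion identity gives C(s)^-1 e_l P(s) = U(s), whose first block is the
    identity.\<close>
  have TP: "\<forall>\<^sub>F s in at (complex_of_real s0). T s * ?P s = 1\<^sub>m N"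
    using pencil_nonsingular_eventually[OF E A det]
  proof eventually_elim
    case (elim s)
    have "T s * ?P s = cadj (e1 N) * (minv (s \<cdot>\<^sub>m E - A) * ((s \<cdot>\<^sub>m E - A) * U N s))"
      unfolding CU by (simp add: T_def assoc_mult_mat_dim dims)
    also have "\<dots> = cadj (e1 N) * (minv (s \<cdot>\<^sub>m E - A) * (s \<cdot>\<^sub>m E - A) * U N s)"
      using dims by (simp add: assoc_mult_mat_dim)
    also have "\<dots> = 1\<^sub>m N"
      unfolding minv_inverse(2)[OF C elim] left_mult_one_mat[OF kc(3)] e1U ..
    finally show ?case .
  qed
  \<comment> \<open>The rules V^H e_l = e_l S^H and V U_n = U_N S carry the companion identity over
    to the reduced pencil: e_l S^H P(s) S = C_n(s) U_n(s).\<close>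
  have TnP: "\<forall>\<^sub>F s in at (complex_of_real s0). Tn s * (cadj S * ?P s * S) = 1\<^sub>m n"
    using pencil_nonsingular_eventually[OF En An detn[folded En_def An_def]]
  proof eventually_elim
    case (elim s)
    have CnV: "s \<cdot>\<^sub>m En - An = cadj V * (s \<cdot>\<^sub>m E - A) * V"
      unfolding En_def An_def by (rule projected_pencil[OF E A V])
    have "el n * (cadj S * ?P s * S) = (el n * cadj S) * (?P s * S)"
      by (simp add: assoc_mult_mat_dim dims)
    also have "\<dots> = cadj V * ((el N * ?P s) * S)"
      by (simp add: assoc_mult_mat_dim dims flip: Vel)
    also have "\<dots> = cadj V * ((s \<cdot>\<^sub>m E - A) * (U N s * S))"
      unfolding CU[symmetric] using dims by (simp add: assoc_mult_mat_dim)
    also have "\<dots> = (s \<cdot>\<^sub>m En - An) * U n s"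
      unfolding CnV VU[symmetric] using dims by (simp add: assoc_mult_mat_dim)
    finally have eq: "el n * (cadj S * ?P s * S) = (s \<cdot>\<^sub>m En - An) * U n s" .
    have "Tn s * (cadj S * ?P s * S)
        = cadj (e1 n) * (minv (s \<cdot>\<^sub>m En - An) * (el n * (cadj S * ?P s * S)))"
      by (simp add: Tn_def assoc_mult_mat_dim dims)
    also have "\<dots> = cadj (e1 n) * (minv (s \<cdot>\<^sub>m En - An) * (s \<cdot>\<^sub>m En - An) * U n s)"
      unfolding eq using dims by (simp add: assoc_mult_mat_dim)
    also have "\<dots> = 1\<^sub>m n"
      unfolding minv_inverse(2)[OF Cn elim] left_mult_one_mat[OF kc(3)] e1U ..
    finally show ?case .
  qed
  obtain Z \<Delta> where Z: "\<And>s. Z s \<in> carrier_mat (l * n) m" and \<Delta>: "mat_bigo s0 j (l * N) m \<Delta>"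
    and X: "\<forall>\<^sub>F s in at (complex_of_real s0). minv (s \<cdot>\<^sub>m E - A) * Bf = V * Z s + \<Delta> s"
    using resolvent_krylov_expansion[OF E A Bf V det sub] by blast
  \<comment> \<open>The Krylov inclusion concerns the companion pencil. The first block row of its
    expansion is an expansion of P(s)^-1 B, with S in place of V and the same order j.\<close>
  define Z' where "Z' = (\<lambda>s. cadj (e1 n) * Z s)"
  define \<Delta>' where "\<Delta>' = (\<lambda>s. cadj (e1 N) * \<Delta> s)"
  have Z': "Z' s \<in> carrier_mat n m" for s
    unfolding Z'_def using cadj_carrier[OF kc(1)] Z by (rule mult_carrier_mat)
  have \<Delta>': "mat_bigo s0 j N m \<Delta>'"
    unfolding \<Delta>'_def using mat_bigo_mult[OF mat_bigo_const[OF cadj_carrier[OF kc(1)]] \<Delta>] by simp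
  have X': "\<forall>\<^sub>F s in at (complex_of_real s0). T s * B = S * Z' s + \<Delta>' s"
    using X
  proof eventually_elim
    case (elim s)
    have "T s * B = cadj (e1 N) * (minv (s \<cdot>\<^sub>m E - A) * Bf)"
      by (simp add: T_def Bf_eq assoc_mult_mat_dim dims)
    also have "\<dots> = (cadj (e1 N) * V) * Z s + \<Delta>' s"
      unfolding elim \<Delta>'_def
      using dims carrier_matD[OF Z] carrier_matD[OF mat_bigo_carrier[OF \<Delta>]]
      by (simp add: mult_add_distrib_dim assoc_mult_mat_dim)
    also have "\<dots> = S * Z' s + \<Delta>' s"
      unfolding e1V Z'_def using dims carrier_matD[OF Z] by (simp add: assoc_mult_mat_dim)
    finally show ?case .
  qed
  have bT: "mat_bigo s0 0 N N T"
    using mat_bigo_mult[OF mat_bigo_const[OF cadj_carrier[OF kc(1)]]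
        mat_bigo_mult[OF mat_bigo_resolvent[OF E A det] mat_bigo_const[OF kc(2)]]]
    by (simp add: T_def)
  have bTn: "mat_bigo s0 0 n n Tn"
    using mat_bigo_mult[OF mat_bigo_const[OF cadj_carrier[OF kc(1)]]
        mat_bigo_mult[OF mat_bigo_resolvent[OF En An detn[folded En_def An_def]] mat_bigo_const[OF kc(2)]]]
    by (simp add: Tn_def)
  note dT = carrier_matD[OF mat_bigo_carrier[OF bT]] carrier_matD[OF mat_bigo_carrier[OF bTn]]
  have bP: "mat_bigo s0 0 N N ?P"
    by (rule mat_bigo_cont) (auto simp: mat_poly_def intro!: continuous_intros)
  have cnjP: "cnj (P t $$ (k,i)) = P t $$ (i,k)" if "t \<le> l" "i < N" "k < N" for t i k
  proof -
    have "cadj (P t) $$ (i,k) = P t $$ (i,k)" using P(2)[OF that(1)] by (simp add: hermitian_mat_def)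
    then show ?thesis using P(1)[OF that(1)] that by simp
  qed
  have "cadj (?P s) = ?P (cnj s)" for s
    by (rule eq_matI) (auto simp: mat_poly_def cnjP)
  \<comment> \<open>Hermitian coefficients give P(s)^H = P(cnj s), so the identity can serve as
    J.\<close>
  then have sym: "cadj (?P s) * 1\<^sub>m N = 1\<^sub>m N * ?P (cnj s)" for s by (simp add: mat_poly_def)
  have sol: "\<forall>\<^sub>F s in at (complex_of_real s0). ?P s * (S * Z' s + \<Delta>' s) = B"
    using X' TP
  proof eventually_elim
    case (elim s)
    have "?P s * T s = 1\<^sub>m N"
      by (rule mat_mult_left_right_inverse[OF mat_bigo_carrier[OF bT] mat_poly_carrier elim(2)])
    then have "?P s * T s * B = B" using B by simp
    then have "?P s * (T s * B) = B" by (simp add: assoc_mult_mat_dim dims dT)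
    then show ?case using elim(1) by simp
  qed
  obtain F where F: "mat_bigo s0 (2 * j) m m F"
    and ev: "\<forall>\<^sub>F s in at (complex_of_real s0). cadj B * (S * Z' s + \<Delta>' s)
      - cadj B * (S * (Tn s * (cadj S * B))) = F s"
    using two_sided_projection_error[OF bP S B, of "1\<^sub>m N" "1\<^sub>m n", OF _ _ _ _ sym Z' \<Delta>' sol bTn TnP] S B
    by auto
  have "(\<lambda>s. transfer En An (cadj V * Bf) (Lf * V) D s $$ (a,b) - transfer E A Bf Lf D s $$ (a,b))
    \<in> O[at (complex_of_real s0)](\<lambda>s. (s - complex_of_real s0) ^ (2 * j))"
  proof (rule bigo_entry_of_eventually[OF F D _ _ _ _ _ ab])
    show "cadj B * (T s * B) \<in> carrier_mat m m" "cadj B * (S * (Tn s * (cadj S * B))) \<in> carrier_mat m m" for s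
      by (intro carrier_matI; simp add: dims)+
    show "transfer E A Bf Lf D s = D + cadj B * (T s * B)" for s
      by (simp add: transfer_def T_def Lf_eq Bf_eq assoc_mult_mat_dim dims)
    have LV: "Lf * V = cadj B * (S * cadj (e1 n))"
      unfolding e1V[symmetric] by (simp add: Lf_eq assoc_mult_mat_dim dims)
    have VB: "cadj V * Bf = el n * (cadj S * B)"
    proof -
      have "cadj V * Bf = (cadj V * el N) * B" by (simp add: Bf_eq assoc_mult_mat_dim dims)
      then show ?thesis unfolding Vel by (simp add: assoc_mult_mat_dim dims)
    qed
    show "transfer En An (cadj V * Bf) (Lf * V) D s = D + cadj B * (S * (Tn s * (cadj S * B)))" for s
      unfolding transfer_def LV VB by (simp add: Tn_def assoc_mult_mat_dim dims)
    show "\<forall>\<^sub>F s in at (complex_of_real s0). cadj B * (T s * B)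
        - cadj B * (S * (Tn s * (cadj S * B))) = F s"
      using ev X' by eventually_elim simp
  qed
  then show ?thesis by (simp add: En_def An_def)
qed

section \<open>Assembly of the three Hermitian cases\<close>

theorem theorem2:
  fixes E A Bf Lf Df Vn :: "complex mat" and s0 :: real and j :: nat
  defines "M \<equiv> Mmat E A s0" and "R \<equiv> Rmat E A Bf s0"
  defines "En \<equiv> cadj Vn * E * Vn" and "An \<equiv> cadj Vn * A * Vn"
      and "Bn \<equiv> cadj Vn * Bf" and "Ln \<equiv> Lf * Vn" and "Dn \<equiv> Df"
  assumes herm:
    "(\<exists>N N0 P0 P1 F G B D. herm_a1 N N0 P0 P1 F G B D E A Bf Lf Df
          \<and> proj_a N N0 G (krylov_space M R j) Vn)
     \<or> (\<exists>N N0 P0 P1 F G B D. herm_a2 N N0 P0 P1 F G B D E A Bf Lf Df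
          \<and> proj_a N N0 G (krylov_space M R j) Vn)
     \<or> (\<exists>N l P B D. herm_b N l P B D E A Bf Lf Df
          \<and> proj_b N l (nblk M R j) (krylov_space M R j) Vn)"
  and reg: "regular_pencil E A"
  and s0_ok: "nonsingular (complex_of_real s0 \<cdot>\<^sub>m E - A)"
  and j_lb: "1 \<le> j"
  and j_ub: "\<exists>j'. j \<le> j' \<and> 0 < mblk M R j'"
  and reg_n: "regular_pencil En An"
  and s0_ok_n: "nonsingular (complex_of_real s0 \<cdot>\<^sub>m En - An)"
  shows "\<forall>a < dim_row Df. \<forall>b < dim_col Df.
           (\<lambda>s. transfer En An Bn Ln Dn s $$ (a,b) - transfer E A Bf Lf Df s $$ (a,b))
             \<in> O[at (complex_of_real s0)](\<lambda>s. (s - complex_of_real s0) ^ (2 * j))"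
proof (intro allI impI)
  fix a b assume ab: "a < dim_row Df" "b < dim_col Df"
  have det: "det (complex_of_real s0 \<cdot>\<^sub>m E - A) \<noteq> 0"
    using s0_ok by (simp add: nonsingular_def)
  have detn: "det (complex_of_real s0 \<cdot>\<^sub>m (cadj Vn * E * Vn) - cadj Vn * A * Vn) \<noteq> 0"
    using s0_ok_n by (simp add: nonsingular_def En_def An_def)
  let ?goal = "(\<lambda>s. transfer (cadj Vn * E * Vn) (cadj Vn * A * Vn) (cadj Vn * Bf) (Lf * Vn) Df s $$ (a,b)
      - transfer E A Bf Lf Df s $$ (a,b))
    \<in> O[at (complex_of_real s0)](\<lambda>s. (s - complex_of_real s0) ^ (2 * j))"
  \<comment> \<open>Each description contains D = Df; substituting it first lets all cases refer to
    the same feedthrough matrix.\<close>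
  have Df: "D = Df" if "herm_a1 N N0 P0 P1 F G B D E A Bf Lf Df"
      for N N0 P0 P1 F G B D using that unfolding herm_a1_def by blast
  have Df': "D = Df" if "herm_a2 N N0 P0 P1 F G B D E A Bf Lf Df"
      for N N0 P0 P1 F G B D using that unfolding herm_a2_def by blast
  have Df'': "D = Df" if "herm_b N l P B D E A Bf Lf Df"
      for N l P B D using that unfolding herm_b_def by blast
  from herm consider (a1) N N0 P0 P1 F G B where "herm_a1 N N0 P0 P1 F G B Df E A Bf Lf Df"
      "proj_a N N0 G (krylov_space M R j) Vn"
    | (a2) N N0 P0 P1 F G B where "herm_a2 N N0 P0 P1 F G B Df E A Bf Lf Df"
      "proj_a N N0 G (krylov_space M R j) Vn"
    | (b) N l P B where "herm_b N l P B Df E A Bf Lf Df"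
      "proj_b N l (nblk M R j) (krylov_space M R j) Vn"
    using Df Df' Df'' by metis
  then have ?goal
  proof cases
    case a1
    note h = a1(1)[unfolded herm_a1_def]
    from h have D: "Df \<in> carrier_mat (dim_col B) (dim_col B)" by blast
    \<comment> \<open>Reduction of the first variant to the common form: F G takes the role of F,
      and the adjoint of G in E is G itself.\<close>
    from h have FG: "F * G \<in> carrier_mat N N0" by (meson mult_carrier_mat)
    from h have E: "E = blkdiag2 P1 G" unfolding hermitian_mat_def by metis
    show ?thesis
      by (rule moment_match_special_second_order[where ?P0.0 = P0 and ?P1.0 = P1
            and F = "F * G" and G = G and B = B and ?N0.0 = N0 and N = N and m = "dim_col B",
            OF _ _ _ _ _ _ FG _ D _ E _ _ a1(2)[unfolded M_def R_def] det detn])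
        (insert h ab[unfolded carrier_matD[OF D]], elim conjE, assumption)+
  next
    case a2
    note h = a2(1)[unfolded herm_a2_def]
    from h have D: "Df \<in> carrier_mat (dim_col B) (dim_col B)" by blast
    show ?thesis
      by (rule moment_match_special_second_order[where ?P0.0 = P0 and ?P1.0 = P1
            and F = F and G = G and B = B and ?N0.0 = N0 and N = N and m = "dim_col B",
            OF _ _ _ _ _ _ _ _ D _ _ _ _ a2(2)[unfolded M_def R_def] det detn])
        (insert h ab[unfolded carrier_matD[OF D]], elim conjE, assumption)+
  next
    case b
    note h = b(1)[unfolded herm_b_def]
    from h have D: "Df \<in> carrier_mat (dim_col B) (dim_col B)" by blast
    from h have P: "\<And>i. i \<le> l \<Longrightarrow> P i \<in> carrier_mat N N" "\<And>i. i \<le> l \<Longrightarrow> hermitian_mat (P i)"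
      by blast+
    show ?thesis
      by (rule moment_match_higher_order[where P = P and N = N and l = l and B = B and m = "dim_col B",
            OF _ P _ D _ _ _ _ b(2)[unfolded M_def R_def] det detn])
        (insert h ab[unfolded carrier_matD[OF D]], elim conjE, assumption)+
  qed
  then show "(\<lambda>s. transfer En An Bn Ln Dn s $$ (a,b) - transfer E A Bf Lf Df s $$ (a,b))
      \<in> O[at (complex_of_real s0)](\<lambda>s. (s - complex_of_real s0) ^ (2 * j))"
    by (simp add: En_def An_def Bn_def Ln_def Dn_def)
qed

end
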